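(* (a) Let $\mathcal{G}(\rho)=(\mathcal{G}_i(\rho))_{i=1}^n$ with $\mathcal{G}_i\in C^\infty(\mathcal{P}_+(G))$. The divergence operator $\mathrm{div}_W(\cdot):(C^\infty(\mathcal{P}_+(G)))^n\to C^\infty(\mathcal{P}_+(G))$ satisfies $$\mathrm{div}_W\mathcal{G}(\rho)=\Pi(\rho)^{\frac12}\nabla_\rho\cdot\big(\mathcal{G}(\rho)\Pi(\rho)^{-\frac12}\big)=\nabla_\rho\cdot\mathcal{G}(\rho)-\frac12\mathcal{G}(\rho)^{\mathsf T}d_\rho\log\Pi(\rho),$$ where $\nabla_\rho\cdot=\sum_{i=1}^n\frac{\partial}{\partial\rho_i}$, i.e. $\nabla_\rho\cdot\mathcal{G}=\sum_{i=1}^n\frac{\partial}{\partial\rho_i}\mathcal{G}_i$. (b) Let $\mathcal{F}\in C^\infty(\mathcal{P}_+(G))$. The Laplace-Beltrami operator $\Delta_W:C^\infty(\mathcal{P}_+(G))\to C^\infty(\mathcal{P}_+(G))$ satisfies $$\begin{aligned}\Delta_W\mathcal{F}(\rho)&=\Pi(\rho)^{\frac12}\nabla_\rho\cdot\big(\Pi(\rho)^{-\frac12}L(\rho)d_\rho\mathcal{F}(\rho)\big)\\&=\mathrm{tr}\big(L(\rho)\cdot d^2_\rho\mathcal{F}(\rho)\big)-\frac12(d_\rho\mathcal{F}(\rho))^{\mathsf T}L(\rho)\big(d_\rho\log\Pi(\rho)\big)\\&=\sum_{(i,j)\in\vec E}\omega_{ij}\theta_{ij}(\rho)\Big(\frac{\partial^2}{\partial\rho_i^2}-2\frac{\partial^2}{\partial\rho_i\partial\rho_j}+\frac{\partial^2}{\partial\rho_j^2}\Big)\mathcal{F}(\rho)-\frac12\sum_{(i,j)\in\vec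 E}\nabla_{ij}d_\rho\log\Pi(\rho)\cdot\nabla_{ij}d_\rho\mathcal{F}(\rho)\,\theta_{ij}(\rho).\end{aligned}$$
   Context: $G=(V,E,\omega)$ is a connected, weighted, undirected finite graph with vertex set $V=\{1,\dots,n\}$, edge set $E$ and weights $\omega_{ij}=\omega_{ji}>0$ if $(i,j)\in E$, $\omega_{ij}=0$ otherwise; $N(i)=\{j:(i,j)\in E\}$; $\vec E$ contains each undirected edge exactly once, with an arbitrary orientation. For $\Phi\in\mathbb{R}^n$, $\nabla_{ij}\Phi=\sqrt{\omega_{ij}}(\Phi(i)-\Phi(j))$. For $a\in\mathbb{R}^n$ put $\theta_{ij}(a)=\frac{a_i+a_j}{2}$; the linear weighted Laplacian matrix $L(a)\in\mathbb{R}^{n\times n}$ is given by $(L(a)\Phi)(i)=\sum_{j\in N(i)}\omega_{ij}\theta_{ij}(a)(\Phi(i)-\Phi(j))$. $A^\dagger$ is the Moore-Penrose pseudo-inverse. For $\rho\in\mathcal{P}_+(G)$, $L(\rho)$ has eigenvalues $0=\lambda_0(\rho)<\lambda_1(\rho)\le\dots\le\lambda_{n-1}(\rho)$, and $\Pi(\rho)=\prod_{i=1}^{n-1}\lambda_i(\rho)$ is the product of the positive ones. $\mathcal{P}_+(G)=\{\rho\in\mathbb{R}^n:\sum_i\rho_i=1,\ \rho_i>0\}$, with tangent space $T_\rho\mathcal{P}_+(G)=\{\sigma\in\mathbb{R}^n:\sum_i\sigma_i=0\}$, carries the Riemannian metric $g_W(\sigma_1,\sigma_2)=\sigma_1^{\mathsf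 T}L(\rho)^\dagger\sigma_2$. Its volume form is $d\mathrm{vol}_W=\Pi(\rho)^{-\frac12}d\mathrm{vol}$, where $d\mathrm{vol}$ is the volume form of $\mathcal{P}_+(G)$ in the Euclidean metric. The gradient is $\nabla_W\mathcal{F}(\rho)=L(\rho)d_\rho\mathcal{F}(\rho)$, with $d_\rho\mathcal{F}=(\partial\mathcal{F}/\partial\rho_i)_{i=1}^n$ and $d^2_\rho\mathcal{F}=(\partial^2\mathcal{F}/\partial\rho_i\partial\rho_j)_{1\le i,j\le n}$ in the Euclidean coordinates $\rho_1,\dots,\rho_n$. $\mathrm{div}_W$ is the divergence operator of $(\mathcal{P}_+(G),g_W)$, based on $d\mathrm{vol}_W$ (integration by parts against $\nabla_W\mathcal{F}$ for compactly supported test functions $\mathcal{F}$), and $\Delta_W\mathcal{F}=\mathrm{div}_W(\nabla_W\mathcal{F})$.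
   Formalization: In (a), the first equality and the smoothness of div_W G are stated for tangent fields (sum of the G_i zero on a neighbourhood of P_+); for arbitrary G the equality fails, e.g. n=2, G=(1,1): div_W G=0 but the right side is -1. *)

theory Defs
  imports "HOL-Analysis.Analysis" "HOL-Computational_Algebra.Polynomial"
begin

subsection \<open>Smooth functions and Euclidean derivatives\<close>

definition partial :: "'n::finite \<Rightarrow> (real^'n \<Rightarrow> real) \<Rightarrow> real^'n \<Rightarrow> real" where
  "partial i f x = deriv (\<lambda>t. f (x + t *\<^sub>R axis i 1)) 0"

primrec Ck_on :: "nat \<Rightarrow> (real^'n::finite) set \<Rightarrow> (real^'n \<Rightarrow> real) \<Rightarrow> bool" where
  "Ck_on 0 U f \<longleftrightarrow> continuous_on U f"
| "Ck_on (Suc k) U f \<longleftrightarrow> f differentiable_on U \<and> (\<forall>i. Ck_on k U (partial i f))"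

text \<open>
  A smooth function on a non-open set \<open>S\<close> is one that extends smoothly to an open neighbourhood.
  In \<open>smooth_near\<close> the given function is itself such an extension, so that its
  partial derivatives in the ambient coordinates make sense at the points of \<open>S\<close>;
  \<open>smooth_fun_on\<close> refers only to the values of the function on \<open>S\<close>.
\<close>

definition smooth_near :: "(real^'n::finite) set \<Rightarrow> (real^'n \<Rightarrow> real) \<Rightarrow> bool" where
  "smooth_near S f \<longleftrightarrow> (\<exists>U. open U \<and> S \<subseteq> U \<and> (\<forall>k. Ck_on k U f))"

definition smooth_fun_on :: "(real^'n::finite) set \<Rightarrow> (real^'n \<Rightarrow> real) \<Rightarrow> bool" where
  "smooth_fun_on S f \<longleftrightarrow> (\<exists>g. smooth_near S g \<and> (\<forall>x\<in>S. f x = g x))"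

definition egrad :: "(real^'n::finite \<Rightarrow> real) \<Rightarrow> real^'n \<Rightarrow> real^'n" where
  "egrad f x = (\<chi> i. partial i f x)"

definition ehess :: "(real^'n::finite \<Rightarrow> real) \<Rightarrow> real^'n \<Rightarrow> real^'n^'n" where
  "ehess f x = (\<chi> i j. partial i (partial j f) x)"

definition ediv :: "(real^'n::finite \<Rightarrow> real^'n) \<Rightarrow> real^'n \<Rightarrow> real" where
  "ediv X x = (\<Sum>i\<in>UNIV. partial i (\<lambda>y. X y $ i) x)"


subsection \<open>Matrices\<close>

definition pseudo_inverse :: "real^'n::finite^'n \<Rightarrow> real^'n^'n" where
  "pseudo_inverse A = (THE B. A ** B ** A = A \<and> B ** A ** B = B \<and>
     transpose (A ** B) = A ** B \<and> transpose (B ** A) = B ** A)"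

definition charpoly :: "real^'n::finite^'n \<Rightarrow> real poly" where
  "charpoly A = det (mat [:0, 1:] - map_matrix (\<lambda>c. [:c:]) A)"

definition pos_eigenvalues_prod :: "real^'n::finite^'n \<Rightarrow> real" where
  "pos_eigenvalues_prod A =
     (\<Prod>x | poly (charpoly A) x = 0 \<and> x > 0. x ^ order x (charpoly A))"


subsection \<open>Weighted graphs\<close>

text \<open>
  The vertex set is the whole of the finite type \<open>'n\<close>, and \<open>E\<close> contains an undirected edge in both
  directions. Loops are not excluded; they do not contribute to any of the notions below.
\<close>

definition connected_weighted_graph :: "('n::finite \<times> 'n) set \<Rightarrow> ('n \<Rightarrow> 'n \<Rightarrow> real) \<Rightarrow> bool" where
  "connected_weighted_graph E \<omega> \<longleftrightarrow>
     sym E \<and> (\<forall>i j. (i, j) \<in> E\<^sup>*) \<and>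
     (\<forall>i j. \<omega> i j = \<omega> j i) \<and>
     (\<forall>i j. (i, j) \<in> E \<longrightarrow> \<omega> i j > 0) \<and>
     (\<forall>i j. (i, j) \<notin> E \<longrightarrow> \<omega> i j = 0)"

definition orientation_of :: "('n \<times> 'n) set \<Rightarrow> ('n \<times> 'n) set \<Rightarrow> bool" where
  "orientation_of E Eo \<longleftrightarrow> Eo \<union> Eo\<inverse> = E \<and> antisym Eo"

definition nbhd :: "('n \<times> 'n) set \<Rightarrow> 'n \<Rightarrow> 'n set" where
  "nbhd E i = {j. (i, j) \<in> E}"

definition ngrad :: "('n::finite \<Rightarrow> 'n \<Rightarrow> real) \<Rightarrow> 'n \<Rightarrow> 'n \<Rightarrow> real^'n \<Rightarrow> real" where
  "ngrad \<omega> i j \<Phi> = sqrt (\<omega> i j) * (\<Phi> $ i - \<Phi> $ j)"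

definition theta :: "real^'n::finite \<Rightarrow> 'n \<Rightarrow> 'n \<Rightarrow> real" where
  "theta a i j = (a $ i + a $ j) / 2"

definition Lap ::
  "('n::finite \<times> 'n) set \<Rightarrow> ('n \<Rightarrow> 'n \<Rightarrow> real) \<Rightarrow> real^'n \<Rightarrow> real^'n^'n" where
  "Lap E \<omega> a =
     matrix (\<lambda>\<Phi>. \<chi> i. \<Sum>j\<in>nbhd E i. \<omega> i j * theta a i j * (\<Phi> $ i - \<Phi> $ j))"

definition Pi_ev ::
  "('n::finite \<times> 'n) set \<Rightarrow> ('n \<Rightarrow> 'n \<Rightarrow> real) \<Rightarrow> real^'n \<Rightarrow> real" where
  "Pi_ev E \<omega> a = pos_eigenvalues_prod (Lap E \<omega> a)"


subsection \<open>The Wasserstein geometry of the open simplex\<close>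

definition simplex_pos :: "(real^'n::finite) set" where
  "simplex_pos = {\<rho>. (\<Sum>i\<in>UNIV. \<rho> $ i) = 1 \<and> (\<forall>i. \<rho> $ i > 0)}"

definition gW :: "('n::finite \<times> 'n) set \<Rightarrow> ('n \<Rightarrow> 'n \<Rightarrow> real) \<Rightarrow>
    real^'n \<Rightarrow> real^'n \<Rightarrow> real^'n \<Rightarrow> real" where
  "gW E \<omega> \<rho> \<sigma>1 \<sigma>2 = \<sigma>1 \<bullet> (pseudo_inverse (Lap E \<omega> \<rho>) *v \<sigma>2)"

definition gradW :: "('n::finite \<times> 'n) set \<Rightarrow> ('n \<Rightarrow> 'n \<Rightarrow> real) \<Rightarrow>
    (real^'n \<Rightarrow> real) \<Rightarrow> real^'n \<Rightarrow> real^'n" where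
  "gradW E \<omega> F \<rho> = Lap E \<omega> \<rho> *v egrad F \<rho>"

text \<open>
  The Euclidean volume of the simplex, a piece of the hyperplane with unit normal
  \<open>\<nu> = (1, \<dots>, 1) / sqrt n\<close>: the volume of a subset \<open>A\<close> is the \<open>n\<close>-dimensional
  Lebesgue measure of the right prism of height one over it, i.e. of the set of all points
  whose orthogonal projection to the hyperplane lies in \<open>A\<close> and whose \<open>\<nu>\<close>-coordinate lies in \<open>[0, 1]\<close>.
\<close>

definition proj_hyp :: "real^'n::finite \<Rightarrow> real^'n" where
  "proj_hyp x = (\<chi> i. x $ i + (1 - (\<Sum>j\<in>UNIV. x $ j)) / real CARD('n))"

definition unit_prism :: "(real^'n::finite) set" where
  "unit_prism = {x. proj_hyp x \<in> simplex_pos \<and>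
     (\<Sum>j\<in>UNIV. x $ j) / sqrt (real CARD('n)) \<in> {0..1}}"

definition vol_euclid :: "(real^'n::finite) measure" where
  "vol_euclid = distr (restrict_space lborel unit_prism) (restrict_space borel simplex_pos) proj_hyp"

definition volW ::
  "('n::finite \<times> 'n) set \<Rightarrow> ('n \<Rightarrow> 'n \<Rightarrow> real) \<Rightarrow> (real^'n) measure" where
  "volW E \<omega> = density vol_euclid (\<lambda>\<rho>. ennreal (Pi_ev E \<omega> \<rho> powr (-1/2)))"

definition test_fun :: "(real^'n::finite \<Rightarrow> real) \<Rightarrow> bool" where
  "test_fun \<phi> \<longleftrightarrow> smooth_near simplex_pos \<phi> \<and>
     (\<exists>K. compact K \<and> K \<subseteq> simplex_pos \<and> (\<forall>\<rho>\<in>simplex_pos - K. \<phi> \<rho> = 0))"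

text \<open>
  The divergence of \<open>G\<close> is the unique smooth function on the simplex satisfying the
  integration by parts formula. Membership in \<open>extensional simplex_pos\<close> only fixes its irrelevant
  values outside of the simplex.
\<close>

definition is_divW :: "('n::finite \<times> 'n) set \<Rightarrow> ('n \<Rightarrow> 'n \<Rightarrow> real) \<Rightarrow>
    (real^'n \<Rightarrow> real^'n) \<Rightarrow> (real^'n \<Rightarrow> real) \<Rightarrow> bool" where
  "is_divW E \<omega> G D \<longleftrightarrow>
     smooth_fun_on simplex_pos D \<and>
     (\<forall>\<phi>. test_fun \<phi> \<longrightarrow>
        (LINT \<rho>|volW E \<omega>. \<phi> \<rho> * D \<rho>) =
        - (LINT \<rho>|volW E \<omega>. gW E \<omega> \<rho> (gradW E \<omega> \<phi> \<rho>) (G \<rho>)))"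

definition divW :: "('n::finite \<times> 'n) set \<Rightarrow> ('n \<Rightarrow> 'n \<Rightarrow> real) \<Rightarrow>
    (real^'n \<Rightarrow> real^'n) \<Rightarrow> real^'n \<Rightarrow> real" where
  "divW E \<omega> G = (THE D. D \<in> extensional simplex_pos \<and> is_divW E \<omega> G D)"

definition LaplaceW :: "('n::finite \<times> 'n) set \<Rightarrow> ('n \<Rightarrow> 'n \<Rightarrow> real) \<Rightarrow>
    (real^'n \<Rightarrow> real) \<Rightarrow> real^'n \<Rightarrow> real" where
  "LaplaceW E \<omega> F = divW E \<omega> (gradW E \<omega> F)"

text \<open>
  A vector field on the simplex takes values in the vectors with coordinate sum zero. The ambient
  divergence \<open>ediv\<close> also sees how the extension of the field varies in the normal direction, so
  the extension has to keep this property on a neighbourhood of the simplex.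
\<close>

definition tangent_near_simplex :: "(real^'n::finite \<Rightarrow> real^'n) \<Rightarrow> bool" where
  "tangent_near_simplex G \<longleftrightarrow>
     (\<exists>U. open U \<and> simplex_pos \<subseteq> U \<and> (\<forall>x\<in>U. (\<Sum>i\<in>UNIV. G x $ i) = 0))"

end

theory Submission
  imports Defs "HOL-Real_Asymp.Real_Asymp"
begin

text \<open>
  The metric \<open>g_W\<close> is built from the pseudo-inverse of \<open>L(\<rho>)\<close>, and \<open>L(\<rho>) L(\<rho>)\<^sup>\<dagger>\<close> is the orthogonal
  projection to the vectors with coordinate sum zero. Hence
  \<open>g_W(\<nabla>_W \<phi>, G) = d\<phi> \<bullet> G\<close> for every tangent field \<open>G\<close> (\<open>gW_gradW\<close>): the metric cancels, and
  the integration by parts formula that defines \<open>div_W\<close> only involves the Euclidean pairing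
  and the density \<open>w = \<Pi>\<^sup>-\<^sup>1\<^sup>/\<^sup>2\<close> of the volume. The formula
  \<open>div_W G = w\<^sup>-\<^sup>1 \<nabla> \<bullet> (w G)\<close> is then Gauss's theorem for the compactly supported field \<open>\<phi> w G\<close>
  together with the Leibniz rule, and its second form is the logarithmic derivative of \<open>w\<close>.

  Three points carry the argument.

  \<^item> The density has to be smooth. On the positive orthant \<open>L(a)\<close> is positive semidefinite, and its
    kernel consists of the constant vectors since the graph is connected. In an orthonormal
    eigenbasis, adding the projection \<open>P\<close> to the constants replaces the eigenvalue zero by one, so
    \<open>\<Pi>(a) = det (L(a) + P)\<close> (\<open>pos_eigenvalues_prod_eq_det\<close>), a positive polynomial in \<open>a\<close>.
    Also \<open>L\<^sup>\<dagger> = (L + P)\<^sup>-\<^sup>1 - P\<close> (\<open>mult_pseudo_inverse\<close>).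

  \<^item> Gauss's theorem on the simplex (\<open>integral_ediv_tangent_eq_0\<close>). The Euclidean volume is Lebesgue
    measure on a prism of height one over the simplex. The slab between two parallel hyperplanes
    that contains the prism is invariant under translations by vectors \<open>v\<close> with coordinate sum
    zero. So the integral over the slab of a function with bounded support there does not
    change when the function is translated along \<open>v\<close>, and differentiating under the integral
    shows that derivatives in the direction \<open>v\<close> have integral zero. For a tangent field the ambient divergence is a sum of such derivatives.

  \<^item> The divergence is determined by its integrals against test functions, because smooth bump
    functions exist (\<open>vanishing_against_test_funs\<close>).

  For the Laplace-Beltrami operator the divergence formula is applied to \<open>L dF\<close>. The first-order terms
  in \<open>\<nabla> \<bullet> (L dF)\<close> cancel because \<open>\<theta>\<close> is an arithmetic mean, whose partial derivatives are the
  same constant for both end points of an edge; what remains is a sum over ordered pairs of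
  vertices, which gives the trace and, after pairing the two orientations of an edge, the sum over
  oriented edges. Both need the symmetry of second derivatives.
\<close>

section \<open>Smooth functions\<close>

definition smooth_on :: "(real^'n::finite) set \<Rightarrow> (real^'n \<Rightarrow> real) \<Rightarrow> bool" where
  "smooth_on U f \<longleftrightarrow> (\<forall>k. Ck_on k U f)"

lemma partial_eq_derivative:
  assumes "(f has_derivative f') (at x)"
  shows "partial i f x = f' (axis i 1)"
proof -
  have "((\<lambda>t. f (x + t *\<^sub>R axis i 1)) has_derivative (\<lambda>t. f' (t *\<^sub>R axis i 1))) (at 0)"
    by (rule has_derivative_compose[of "\<lambda>t. x + t *\<^sub>R axis i 1" "\<lambda>t. t *\<^sub>R axis i 1", where g=f])
      (auto intro!: derivative_eq_intros assms)
  moreover have "f' (t *\<^sub>R axis i 1) = f' (axis i 1) * t" for t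
    using linear_cmul[OF has_derivative_linear[OF assms]] by simp
  ultimately have "((\<lambda>t. f (x + t *\<^sub>R axis i 1)) has_field_derivative f' (axis i 1)) (at 0)"
    by (simp add: has_field_derivative_def)
  then show ?thesis unfolding partial_def by (rule DERIV_imp_deriv)
qed

lemma has_derivative_egrad:
  assumes "f differentiable (at x)"
  shows "(f has_derivative (\<lambda>v. v \<bullet> egrad f x)) (at x)"
proof -
  obtain f' where f': "(f has_derivative f') (at x)"
    using assms by (auto simp: differentiable_def)
  have "f' v = v \<bullet> egrad f x" for v
  proof -
    have "f' v = f' (\<Sum>i\<in>UNIV. v $ i *\<^sub>R axis i 1)"
      by (simp add: basis_expansion flip: scalar_mult_eq_scaleR)
    also have "\<dots> = (\<Sum>i\<in>UNIV. v $ i * f' (axis i 1))"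
      using has_derivative_linear[OF f'] by (simp add: linear_sum linear_cmul)
    also have "\<dots> = v \<bullet> egrad f x"
      by (simp add: inner_vec_def egrad_def partial_eq_derivative[OF f'])
    finally show ?thesis .
  qed
  then show ?thesis using f' by (metis (no_types, lifting) ext)
qed

lemma has_real_derivative_along_line:
  assumes "f differentiable (at (x + t *\<^sub>R v))"
  shows "((\<lambda>t. f (x + t *\<^sub>R v)) has_real_derivative v \<bullet> egrad f (x + t *\<^sub>R v)) (at t)"
proof -
  have "((\<lambda>t. f (x + t *\<^sub>R v)) has_derivative (\<lambda>s. (s *\<^sub>R v) \<bullet> egrad f (x + t *\<^sub>R v))) (at t)"
    by (rule has_derivative_compose[of "\<lambda>t. x + t *\<^sub>R v" "\<lambda>s. s *\<^sub>R v", where g=f])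
      (auto intro!: derivative_eq_intros has_derivative_egrad assms)
  then show ?thesis by (simp add: has_field_derivative_def mult_commute_abs)
qed

lemma differentiable_on_imp_at:
  "f differentiable_on U \<Longrightarrow> open U \<Longrightarrow> x \<in> U \<Longrightarrow> f differentiable (at x)"
  by (metis at_within_open differentiable_on_def)

lemma differentiable_cong_open:
  assumes "open U" "x \<in> U" "\<And>y. y \<in> U \<Longrightarrow> f y = g y" "f differentiable (at x)"
  shows "g differentiable (at x)"
  using assms by (meson differentiable_def has_derivative_transform_within_open)

lemma partial_cong_open:
  assumes U: "open U" "x \<in> U" and eq: "\<And>y. y \<in> U \<Longrightarrow> f y = g y"
  shows "partial i f x = partial i g x"
proof -
  have "open ((\<lambda>t. x + t *\<^sub>R axis i 1) -` U :: real set)"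
    by (intro continuous_open_vimage U continuous_intros)
  then have "\<forall>\<^sub>F t in nhds 0. t \<in> (\<lambda>t. x + t *\<^sub>R axis i 1) -` U"
    using U by (intro eventually_nhds_in_open) auto
  then have "\<forall>\<^sub>F t in nhds 0. f (x + t *\<^sub>R axis i 1) = g (x + t *\<^sub>R axis i 1)"
    by eventually_elim (auto intro: eq)
  then show ?thesis unfolding partial_def by (intro deriv_cong_ev) auto
qed

lemma Ck_on_cong:
  assumes "open U" "\<And>y. y \<in> U \<Longrightarrow> f y = g y"
  shows "Ck_on k U f \<longleftrightarrow> Ck_on k U g"
  using assms(2)
proof (induction k arbitrary: f g)
  case 0 then show ?case by (simp cong: continuous_on_cong)
next
  case (Suc k)
  have "Ck_on k U (partial i f) = Ck_on k U (partial i g)" for i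
    by (rule Suc.IH) (rule partial_cong_open[OF assms(1) _ Suc.prems])
  moreover have "f differentiable_on U \<longleftrightarrow> g differentiable_on U"
    unfolding differentiable_on_eq_differentiable_at[OF assms(1)]
    using differentiable_cong_open[OF assms(1), of _ f g] differentiable_cong_open[OF assms(1), of _ g f] Suc.prems
    by metis
  ultimately show ?case by simp
qed

lemma Ck_on_mono: "Ck_on k U f \<Longrightarrow> V \<subseteq> U \<Longrightarrow> Ck_on k V f"
  by (induction k arbitrary: f) (auto intro: continuous_on_subset differentiable_on_subset)

lemma Ck_on_pred: "Ck_on (Suc k) U f \<Longrightarrow> Ck_on k U f"
  by (induction k arbitrary: f) (auto intro: differentiable_imp_continuous_on)

lemma smooth_on_cong:
  assumes "open U" "\<And>y. y \<in> U \<Longrightarrow> f y = g y"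
  shows "smooth_on U f \<longleftrightarrow> smooth_on U g"
  using Ck_on_cong[OF assms] by (simp add: smooth_on_def)

lemma smooth_on_mono: "smooth_on U f \<Longrightarrow> V \<subseteq> U \<Longrightarrow> smooth_on V f"
  by (auto simp: smooth_on_def intro: Ck_on_mono)

lemma smooth_on_differentiable: "smooth_on U f \<Longrightarrow> open U \<Longrightarrow> x \<in> U \<Longrightarrow> f differentiable (at x)"
  unfolding smooth_on_def by (metis Ck_on.simps(2) differentiable_on_imp_at)

lemma smooth_on_partial: "smooth_on U f \<Longrightarrow> smooth_on U (partial i f)"
  unfolding smooth_on_def by (metis Ck_on.simps(2))

lemma smooth_on_continuous_on: "smooth_on U f \<Longrightarrow> continuous_on U f"
  unfolding smooth_on_def by (metis Ck_on.simps(1))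

lemma partial_const [simp]: "partial i (\<lambda>x. c) = (\<lambda>x. 0)"
  by (simp add: partial_def fun_eq_iff)

lemma Ck_on_const: "Ck_on k U (\<lambda>x. c)"
  by (induction k arbitrary: c) auto

lemma smooth_on_const: "smooth_on U (\<lambda>x. c)"
  by (simp add: smooth_on_def Ck_on_const)

lemma partial_coord: "partial i (\<lambda>x::real^'n::finite. x $ j) = (\<lambda>x. if i = j then 1 else 0)"
proof
  fix x :: "real^'n"
  have "((\<lambda>x::real^'n. x $ j) has_derivative (\<lambda>x. x $ j)) (at x)"
    by (rule bounded_linear_imp_has_derivative) (rule bounded_linear_vec_nth)
  from partial_eq_derivative[OF this] show "partial i (\<lambda>x. x $ j) x = (if i = j then 1 else 0)"
    by (auto simp: axis_def)
qed

lemma smooth_on_coord: "smooth_on U (\<lambda>x. x $ j)"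
  unfolding smooth_on_def
proof
  fix k show "Ck_on k U (\<lambda>x. x $ j)"
    by (cases k) (auto simp: partial_coord Ck_on_const intro!: continuous_intros
        bounded_linear_imp_differentiable_on bounded_linear_vec_nth)
qed

lemma partial_add:
  assumes "f differentiable (at x)" "g differentiable (at x)"
  shows "partial i (\<lambda>x. f x + g x) x = partial i f x + partial i g x"
  by (subst partial_eq_derivative[OF has_derivative_add[OF assms[THEN has_derivative_egrad]]])
    (simp add: inner_axis' egrad_def)

lemma partial_mult:
  assumes "f differentiable (at x)" "g differentiable (at x)"
  shows "partial i (\<lambda>x. f x * g x) x = partial i f x * g x + f x * partial i g x"
  by (subst partial_eq_derivative[OF has_derivative_mult[OF assms[THEN has_derivative_egrad]]])
    (simp add: inner_axis' egrad_def)

lemma partial_sum: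
  assumes "\<And>j. j \<in> A \<Longrightarrow> f j differentiable (at x)"
  shows "partial i (\<lambda>x. \<Sum>j\<in>A. f j x) x = (\<Sum>j\<in>A. partial i (f j) x)"
  by (subst partial_eq_derivative[OF has_derivative_sum[OF assms[THEN has_derivative_egrad]]])
    (auto simp: inner_axis' egrad_def)

lemma partial_compose:
  assumes "u differentiable (at x)" "(h has_real_derivative h') (at (u x))"
  shows "partial i (\<lambda>x. h (u x)) x = h' * partial i u x"
  by (subst partial_eq_derivative[OF has_derivative_compose[OF has_derivative_egrad[OF assms(1)]
            assms(2)[unfolded has_field_derivative_def]]])
    (simp add: inner_axis' egrad_def)

lemma Ck_on_add:
  assumes "open U" "Ck_on k U f" "Ck_on k U g"
  shows "Ck_on k U (\<lambda>x. f x + g x)"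
  using assms(2,3)
proof (induction k arbitrary: f g)
  case 0 then show ?case by (auto intro: continuous_intros)
next
  case (Suc k)
  have "Ck_on k U (partial i (\<lambda>x. f x + g x))" for i
  proof -
    have "Ck_on k U (\<lambda>x. partial i f x + partial i g x)"
      using Suc by simp
    then show ?thesis
      by (subst Ck_on_cong[OF assms(1), of _ "\<lambda>x. partial i f x + partial i g x"])
        (use Suc.prems in \<open>auto intro!: partial_add differentiable_on_imp_at[OF _ assms(1)]\<close>)
  qed
  then show ?case using Suc.prems by auto
qed

lemma Ck_on_mult:
  assumes "open U" "Ck_on k U f" "Ck_on k U g"
  shows "Ck_on k U (\<lambda>x. f x * g x)"
  using assms(2,3)
proof (induction k arbitrary: f g)
  case 0 then show ?case by (auto intro: continuous_intros)
next
  case (Suc k)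
  have "Ck_on k U (partial i (\<lambda>x. f x * g x))" for i
  proof -
    have "Ck_on k U (\<lambda>x. partial i f x * g x + f x * partial i g x)"
      using Suc.prems Suc.prems[THEN Ck_on_pred]
      by (intro Ck_on_add[OF assms(1)] Suc.IH) simp_all
    then show ?thesis
      by (subst Ck_on_cong[OF assms(1), of _ "\<lambda>x. partial i f x * g x + f x * partial i g x"])
        (use Suc.prems in \<open>auto intro!: partial_mult differentiable_on_imp_at[OF _ assms(1)]\<close>)
  qed
  then show ?case using Suc.prems by auto
qed

lemma smooth_on_add: "open U \<Longrightarrow> smooth_on U f \<Longrightarrow> smooth_on U g \<Longrightarrow> smooth_on U (\<lambda>x. f x + g x)"
  by (simp add: smooth_on_def Ck_on_add)

lemma smooth_on_mult: "open U \<Longrightarrow> smooth_on U f \<Longrightarrow> smooth_on U g \<Longrightarrow> smooth_on U (\<lambda>x. f x * g x)"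
  by (simp add: smooth_on_def Ck_on_mult)

lemma smooth_on_diff:
  "open U \<Longrightarrow> smooth_on U f \<Longrightarrow> smooth_on U g \<Longrightarrow> smooth_on U (\<lambda>x. f x - g x)"
  using smooth_on_add[of U f "\<lambda>x. -1 * g x"] smooth_on_mult[of U "\<lambda>x. -1" g] smooth_on_const[of U "-1"]
  by simp

lemma smooth_on_sum:
  "open U \<Longrightarrow> (\<And>j. j \<in> A \<Longrightarrow> smooth_on U (f j)) \<Longrightarrow> smooth_on U (\<lambda>x. \<Sum>j\<in>A. f j x)"
  by (induction A rule: infinite_finite_induct) (auto intro: smooth_on_add smooth_on_const)

lemma smooth_on_prod:
  "open U \<Longrightarrow> (\<And>j. j \<in> A \<Longrightarrow> smooth_on U (f j)) \<Longrightarrow> smooth_on U (\<lambda>x. \<Prod>j\<in>A. f j x)"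
  by (induction A rule: infinite_finite_induct) (auto intro: smooth_on_mult smooth_on_const)

lemmas smooth_on_intros = smooth_on_const smooth_on_coord smooth_on_add smooth_on_mult smooth_on_diff
  smooth_on_sum smooth_on_prod smooth_on_partial

text \<open>The family \<open>H\<close> consists of the successive derivatives of one function of a real variable. Proving
  the statement for all of them at once makes the induction on the order of differentiability
  go through, since the chain rule turns \<open>H m\<close> into \<open>H (Suc m)\<close>.\<close>

lemma smooth_on_compose:
  fixes H :: "nat \<Rightarrow> real \<Rightarrow> real"
  assumes U: "open U" and u: "smooth_on U u" and T: "\<And>x. x \<in> U \<Longrightarrow> u x \<in> T"
    and H: "\<And>m t. t \<in> T \<Longrightarrow> (H m has_real_derivative H (Suc m) t) (at t)"
  shows "smooth_on U (\<lambda>x. H m (u x))"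
proof -
  note du = smooth_on_differentiable[OF u U]
  have diff: "(\<lambda>x. H m (u x)) differentiable (at x)" if "x \<in> U" for x m
    using has_derivative_compose[OF has_derivative_egrad[OF du[OF that]]
            H[OF T[OF that], unfolded has_field_derivative_def]]
    by (auto simp: differentiable_def)
  have "Ck_on k U (\<lambda>x. H m (u x))" for k
  proof (induction k arbitrary: m)
    case 0
    then show ?case
      by (simp add: continuous_at_imp_continuous_on differentiable_imp_continuous_within diff)
  next
    case (Suc k)
    have "Ck_on k U (partial i (\<lambda>x. H m (u x)))" for i
    proof -
      have "Ck_on k U (\<lambda>x. H (Suc m) (u x) * partial i u x)"
        using Suc smooth_on_partial[OF u] by (intro Ck_on_mult U) (auto simp: smooth_on_def)
      then show ?thesis
        by (subst Ck_on_cong[OF U, of _ "\<lambda>x. H (Suc m) (u x) * partial i u x"])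
          (auto intro!: partial_compose du H T)
    qed
    then show ?case using diff by (auto simp: differentiable_on_def differentiable_at_withinI)
  qed
  then show ?thesis by (simp add: smooth_on_def)
qed

lemma smooth_on_powr:
  assumes U: "open U" and u: "smooth_on U u" and pos: "\<And>x. x \<in> U \<Longrightarrow> u x > 0"
  shows "smooth_on U (\<lambda>x. u x powr s)"
proof -
  let ?H = "\<lambda>m t. (\<Prod>k<m. s - real k) * t powr (s - real m)"
  have "smooth_on U (\<lambda>x. ?H 0 (u x))"
  proof (rule smooth_on_compose[OF U u, where T="{0<..}"])
    fix m and t :: real assume "t \<in> {0<..}"
    then show "(?H m has_real_derivative ?H (Suc m) t) (at t)"
      by (auto intro!: derivative_eq_intros simp: algebra_simps)
  qed (use pos in auto)
  then show ?thesis by simp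
qed

section \<open>Bump functions\<close>

text \<open>For \<open>p = 1\<close> this is the standard smooth function that vanishes for \<open>t \<le> 0\<close> and is positive for
  \<open>t > 0\<close>; the polynomial factors in \<open>1 / t\<close> make the family closed under differentiation.\<close>

definition flat :: "real poly \<Rightarrow> real \<Rightarrow> real" where
  "flat p t = (if t > 0 then poly p (1 / t) * exp (- (1 / t)) else 0)"

definition flat_deriv :: "real poly \<Rightarrow> real poly" where
  "flat_deriv p = [:0, 0, 1:] * (p - pderiv p)"

lemma poly_times_exp_neg_tendsto_0: "((\<lambda>s. poly p s * exp (- s)) \<longlongrightarrow> (0::real)) at_top"
proof -
  have "((\<lambda>s. \<Sum>i\<le>degree p. coeff p i * (s ^ i / exp s)) \<longlongrightarrow> (\<Sum>i\<le>degree p. coeff p i * 0)) at_top"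
    by (intro tendsto_intros tendsto_power_div_exp_0)
  then show ?thesis
    by (simp add: poly_altdef exp_minus sum_distrib_right sum_divide_distrib field_simps)
qed

lemma flat_has_derivative: "(flat p has_real_derivative flat (flat_deriv p) t) (at t)"
proof -
  consider "t > 0" | "t < 0" | "t = 0" by linarith
  then show ?thesis
  proof cases
    case 1
    have "((\<lambda>t. poly p (1 / t) * exp (- (1 / t))) has_real_derivative flat (flat_deriv p) t) (at t)"
      using 1 by (auto intro!: derivative_eq_intros
          simp: flat_def flat_deriv_def field_simps power2_eq_square)
    then show ?thesis
      by (rule has_field_derivative_transform_within_open[of _ _ _ "{0<..}"])
        (use 1 in \<open>auto simp: flat_def\<close>)
  next
    case 2
    have "((\<lambda>t. 0) has_real_derivative flat (flat_deriv p) t) (at t)"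
      using 2 by (auto simp: flat_def)
    then show ?thesis
      by (rule has_field_derivative_transform_within_open[of _ _ _ "{..<0}"])
        (use 2 in \<open>auto simp: flat_def\<close>)
  next
    case 3
    \<comment> \<open>With \<open>s = 1 / h\<close> the difference quotient from the right is \<open>s p(s) exp (- s)\<close>.\<close>
    have "((\<lambda>s. poly (pCons 0 p) s * exp (- s)) \<longlongrightarrow> 0) at_top"
      by (rule poly_times_exp_neg_tendsto_0)
    then have "((\<lambda>h. poly (pCons 0 p) (inverse h) * exp (- inverse h)) \<longlongrightarrow> 0) (at_right 0)"
      by (rule filterlim_compose[OF _ filterlim_inverse_at_top_right])
    then have "((\<lambda>h. (flat p h - flat p 0) / h) \<longlongrightarrow> 0) (at_right 0)"
      by (rule Lim_transform_eventually)
        (auto simp: eventually_at_right_less flat_def field_simps intro!: eventually_at_rightI[of 0 1])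
    moreover have "((\<lambda>h. (flat p h - flat p 0) / h) \<longlongrightarrow> 0) (at_left 0)"
      by (rule Lim_transform_eventually[OF tendsto_const])
        (auto simp: flat_def intro!: eventually_at_leftI[of "-1" 0])
    ultimately have "((\<lambda>h. (flat p h - flat p 0) / h) \<longlongrightarrow> 0) (at 0)"
      by (simp add: filterlim_at_split)
    then show ?thesis using 3 by (simp add: DERIV_def flat_def)
  qed
qed

lemma smooth_on_flat:
  assumes "open U" "smooth_on U u"
  shows "smooth_on U (\<lambda>x. flat p (u x))"
  using smooth_on_compose[OF assms, of UNIV "\<lambda>m. flat ((flat_deriv ^^ m) p)" 0]
  by (simp add: flat_has_derivative)

definition bump :: "real^'n::finite \<Rightarrow> real \<Rightarrow> real^'n \<Rightarrow> real" where
  "bump y r x = flat 1 (r\<^sup>2 - (\<Sum>i\<in>UNIV. (x $ i - y $ i) * (x $ i - y $ i)))"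

lemma smooth_on_bump: "smooth_on UNIV (bump y r)"
  unfolding bump_def by (intro smooth_on_flat smooth_on_intros open_UNIV)

lemma bump_pos_iff: "r > 0 \<Longrightarrow> bump y r x > 0 \<longleftrightarrow> dist y x < r"
  and bump_nonneg: "bump y r x \<ge> 0"
  and bump_eq_0: "r > 0 \<Longrightarrow> dist y x \<ge> r \<Longrightarrow> bump y r x = 0"
proof -
  have eq: "(\<Sum>i\<in>UNIV. (x $ i - y $ i) * (x $ i - y $ i)) = (dist y x)\<^sup>2"
    by (simp add: dist_norm norm_minus_commute[of y x] inner_vec_def flip: power2_norm_eq_inner)
      (simp add: power2_norm_eq_inner inner_vec_def)
  have "dist y x < r \<longleftrightarrow> (dist y x)\<^sup>2 < r\<^sup>2" if "r > 0"
    using that by (metis less_eq_real_def power2_less_imp_less power_strict_mono zero_le_dist pos2)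
  then show "r > 0 \<Longrightarrow> bump y r x > 0 \<longleftrightarrow> dist y x < r" "r > 0 \<Longrightarrow> dist y x \<ge> r \<Longrightarrow> bump y r x = 0"
    "bump y r x \<ge> 0"
    by (auto simp: bump_def flat_def eq)
qed

section \<open>Symmetry of second derivatives\<close>

text \<open>The mean value theorem is applied in the direction \<open>i\<close> to a difference in the direction \<open>j\<close>, and
  then in the direction \<open>j\<close>.\<close>

lemma second_difference_eq_mixed_partial:
  assumes U: "open U" and f: "smooth_on U f" and h: "h > 0"
    and box: "\<And>s t. 0 \<le> s \<Longrightarrow> s \<le> h \<Longrightarrow> 0 \<le> t \<Longrightarrow> t \<le> h \<Longrightarrow> x + s *\<^sub>R axis i 1 + t *\<^sub>R axis j 1 \<in> U"
  shows "\<exists>s t. 0 < s \<and> s < h \<and> 0 < t \<and> t < h \<and>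
     f (x + h *\<^sub>R axis i 1 + h *\<^sub>R axis j 1) - f (x + h *\<^sub>R axis i 1) - f (x + h *\<^sub>R axis j 1) + f x
       = h\<^sup>2 * partial j (partial i f) (x + s *\<^sub>R axis i 1 + t *\<^sub>R axis j 1)"
proof -
  let ?p = "\<lambda>s t. x + s *\<^sub>R axis i 1 + t *\<^sub>R axis j 1"
  have Di: "((\<lambda>s. g (?p s t)) has_real_derivative partial i g (?p s t)) (at s)"
    if "smooth_on U g" "0 \<le> s" "s \<le> h" "0 \<le> t" "t \<le> h" for g s t
    using has_real_derivative_along_line[of g "x + t *\<^sub>R axis j 1" s "axis i 1"]
      smooth_on_differentiable[OF that(1) U box] that
    by (simp add: ac_simps inner_axis' egrad_def)
  have Dj: "((\<lambda>t. g (?p s t)) has_real_derivative partial j g (?p s t)) (at t)"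
    if "smooth_on U g" "0 \<le> s" "s \<le> h" "0 \<le> t" "t \<le> h" for g s t
    using has_real_derivative_along_line[of g "x + s *\<^sub>R axis i 1" t "axis j 1"]
      smooth_on_differentiable[OF that(1) U box] that
    by (simp add: ac_simps inner_axis' egrad_def)
  have "\<exists>s. 0 < s \<and> s < h \<and> (f (?p h h) - f (?p h 0)) - (f (?p 0 h) - f (?p 0 0))
      = (h - 0) * (partial i f (?p s h) - partial i f (?p s 0))"
    by (rule MVT2[OF h, of "\<lambda>s. f (?p s h) - f (?p s 0)"])
      (intro DERIV_diff Di f; use h in simp)
  then obtain s where s: "0 < s" "s < h" and s_eq:
    "(f (?p h h) - f (?p h 0)) - (f (?p 0 h) - f (?p 0 0))
      = h * (partial i f (?p s h) - partial i f (?p s 0))" by auto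
  have "\<exists>t. 0 < t \<and> t < h \<and> partial i f (?p s h) - partial i f (?p s 0)
      = (h - 0) * partial j (partial i f) (?p s t)"
    by (rule MVT2[OF h, of "\<lambda>t. partial i f (?p s t)"])
      (intro Dj smooth_on_partial f; use s in simp)
  then obtain t where t: "0 < t" "t < h" and
    "partial i f (?p s h) - partial i f (?p s 0) = h * partial j (partial i f) (?p s t)" by auto
  with s_eq s t show ?thesis
    by (intro exI[of _ s] exI[of _ t]) (simp add: power2_eq_square)
qed

text \<open>The second difference does not depend on the order of the two directions, and divided by
  \<open>h\<^sup>2\<close> it converges to the mixed partial derivative in either order.\<close>

lemma partial_commute:
  assumes U: "open U" and f: "smooth_on U f" and x: "x \<in> U"
  shows "partial i (partial j f) x = partial j (partial i f) x"
proof -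
  obtain e where e: "e > 0" "ball x e \<subseteq> U" using U x openE by blast
  let ?h = "\<lambda>m. e / (2 + real m) / 2"
  let ?D = "\<lambda>m. f (x + ?h m *\<^sub>R axis i 1 + ?h m *\<^sub>R axis j 1) - f (x + ?h m *\<^sub>R axis i 1)
      - f (x + ?h m *\<^sub>R axis j 1) + f x"
  have hpos: "?h m > 0" "2 * ?h m < e" for m
  proof -
    show "?h m > 0" using e(1) by simp
    have half: "2 * (a / 2) = a" for a :: real by simp
    have "2 * ?h m = e / (2 + real m)" by (rule half)
    then show "2 * ?h m < e" using e(1) divide_strict_left_mono[of 1 "2 + real m" e] by simp
  qed
  \<comment> \<open>Abstracting from the order of \<open>i\<close> and \<open>j\<close> in \<open>?D\<close> allows both uses below.\<close>
  have lim: "(\<lambda>m. ?D m / (?h m)\<^sup>2) \<longlonglongrightarrow> partial j (partial i f) x"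
    if D: "\<And>m. ?D m = f (x + ?h m *\<^sub>R axis i 1 + ?h m *\<^sub>R axis j 1) - f (x + ?h m *\<^sub>R axis i 1)
      - f (x + ?h m *\<^sub>R axis j 1) + f x" for i j
  proof -
    have near: "norm (s *\<^sub>R axis i 1 + t *\<^sub>R axis j (1::real)) \<le> 2 * h"
      if "0 \<le> s" "s \<le> h" "0 \<le> t" "t \<le> h" for s t h
      using norm_triangle_ineq[of "s *\<^sub>R axis i (1::real)" "t *\<^sub>R axis j 1"] that by simp
    have "\<exists>y. dist y x \<le> 2 * ?h m \<and> ?D m = (?h m)\<^sup>2 * partial j (partial i f) y" for m
    proof -
      have "x + s *\<^sub>R axis i 1 + t *\<^sub>R axis j 1 \<in> U" if "0 \<le> s" "s \<le> ?h m" "0 \<le> t" "t \<le> ?h m" for s t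
      proof -
        have "dist (x + s *\<^sub>R axis i 1 + t *\<^sub>R axis j 1) x \<le> 2 * ?h m"
          using near[OF that] by (simp add: dist_norm add.assoc)
        with hpos[of m] e show ?thesis by (auto simp: dist_commute intro!: subsetD[OF e(2)])
      qed
      from second_difference_eq_mixed_partial[OF U f hpos(1) this]
      obtain s t where st: "0 < s" "s < ?h m" "0 < t" "t < ?h m"
        "?D m = (?h m)\<^sup>2 * partial j (partial i f) (x + s *\<^sub>R axis i 1 + t *\<^sub>R axis j 1)"
        unfolding D by blast
      then show ?thesis
        using near[of s "?h m" t]
        by (intro exI[of _ "x + s *\<^sub>R axis i 1 + t *\<^sub>R axis j 1"]) (simp add: dist_norm add.assoc)
    qed
    then obtain y where y: "\<And>m. dist (y m) x \<le> 2 * ?h m"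
        "\<And>m. ?D m = (?h m)\<^sup>2 * partial j (partial i f) (y m)" by metis
    have "(\<lambda>m. 2 * ?h m) \<longlonglongrightarrow> 0" by real_asymp
    then have "(\<lambda>m. dist (y m) x) \<longlonglongrightarrow> 0"
      by (rule Lim_null_comparison[rotated]) (use y in simp)
    then have "y \<longlonglongrightarrow> x" by (rule tendsto_dist_iff[THEN iffD2])
    moreover have "isCont (partial j (partial i f)) x"
      using smooth_on_continuous_on[OF smooth_on_partial[OF smooth_on_partial[OF f]]] U x
      by (simp add: continuous_on_eq_continuous_at)
    ultimately have "(\<lambda>m. partial j (partial i f) (y m)) \<longlonglongrightarrow> partial j (partial i f) x"
      by (rule isCont_tendsto_compose[rotated])
    moreover have "?D m / (?h m)\<^sup>2 = partial j (partial i f) (y m)" for m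
      using y(2)[of m] hpos[of m] by simp
    ultimately show ?thesis by simp
  qed
  have "(\<lambda>m. ?D m / (?h m)\<^sup>2) \<longlonglongrightarrow> partial j (partial i f) x"
    by (rule lim) simp
  moreover have "(\<lambda>m. ?D m / (?h m)\<^sup>2) \<longlonglongrightarrow> partial i (partial j f) x"
    by (rule lim) (simp add: ac_simps)
  ultimately show ?thesis using LIMSEQ_unique by blast
qed

section \<open>Symmetric matrices: spectrum and pseudo-inverse\<close>

text \<open>A maximum point \<open>v\<close> of the quadratic form on the unit sphere of \<open>S\<close> is an eigenvector: with the
  maximal value \<open>l\<close>, the form \<open>l (x \<bullet> x) - f x \<bullet> x\<close> is nonnegative on \<open>S\<close> and vanishes at \<open>v\<close>, so
  its derivative at \<open>v\<close> in the direction \<open>r = l v - f v\<close>, which is \<open>2 (r \<bullet> r)\<close>, must vanish.\<close>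

lemma rayleigh_eigenvector:
  fixes f :: "'a::euclidean_space \<Rightarrow> 'a"
  assumes f: "linear f" and sa: "\<And>x y. f x \<bullet> y = x \<bullet> f y"
    and S: "subspace S" and inv: "f ` S \<subseteq> S" and ne: "S \<noteq> {0}"
  obtains v l where "v \<in> S" "norm v = 1" "f v = l *\<^sub>R v"
proof -
  let ?K = "S \<inter> sphere 0 1"
  obtain z where "z \<in> S" "z \<noteq> 0" using ne subspace_0[OF S] by blast
  then have "z /\<^sub>R norm z \<in> ?K" using S by (auto simp: subspace_scale)
  then have "?K \<noteq> {}" by blast
  moreover have "compact ?K" by (simp add: closed_Int_compact closed_subspace S)
  moreover have "continuous_on ?K (\<lambda>x. f x \<bullet> x)"
    by (intro continuous_intros linear_continuous_on f linear_conv_bounded_linear[THEN iffD1])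
  ultimately obtain v where v: "v \<in> ?K" and max: "\<And>x. x \<in> ?K \<Longrightarrow> f x \<bullet> x \<le> f v \<bullet> v"
    using continuous_attains_sup[of ?K "\<lambda>x. f x \<bullet> x"] by blast
  define l where "l = f v \<bullet> v"
  have vv: "v \<bullet> v = 1" using v by (simp add: dot_square_norm)
  have bound: "f x \<bullet> x \<le> l * (x \<bullet> x)" if "x \<in> S" for x
  proof (cases "x = 0")
    case False
    have "x /\<^sub>R norm x \<in> ?K" using that False S by (auto simp: subspace_scale)
    from max[OF this] have "(f x \<bullet> x) / (norm x * norm x) \<le> l"
      using f by (simp add: linear_cmul l_def divide_inverse mult_ac)
    then show ?thesis using False by (simp add: dot_square_norm field_simps power2_eq_square)
  qed (use linear_0[OF f] in simp)
  define r where "r = l *\<^sub>R v - f v"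
  have r: "r \<in> S" unfolding r_def
    using v inv S by (auto intro!: subspace_diff subspace_scale)
  have vr: "v \<bullet> r = 0" by (simp add: r_def inner_diff vv l_def inner_commute)
  have fv: "f v = l *\<^sub>R v - r" by (simp add: r_def)
  have "r \<bullet> r = 0"
  proof (rule ccontr)
    assume "r \<bullet> r \<noteq> 0"
    then have rpos: "r \<bullet> r > 0" by simp
    define c where "c = l * (r \<bullet> r) - f r \<bullet> r"
    have nn: "0 \<le> c * t\<^sup>2 + 2 * t * (r \<bullet> r)" for t
    proof -
      have "v + t *\<^sub>R r \<in> S" using v r S by (auto intro!: subspace_add subspace_scale)
      from bound[OF this] show ?thesis
        using sa[of r v] by (simp add: linear_add[OF f] linear_cmul[OF f] inner_add fv inner_diff
            vr vv inner_commute[of r v] c_def algebra_simps power2_eq_square)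
    qed
    \<comment> \<open>A negative \<open>t\<close> so small that the linear term dominates in \<open>nn\<close>.\<close>
    define t where "t = - (r \<bullet> r) / (\<bar>c\<bar> + 1)"
    have t: "t < 0" "\<bar>c\<bar> * t \<ge> - (r \<bullet> r)"
      using rpos by (simp_all add: t_def divide_neg_pos field_simps)
    have "\<bar>c\<bar> * t \<le> c * t" using t by (simp add: mult_right_mono_neg)
    then have "c * t + 2 * (r \<bullet> r) > 0" using t rpos by linarith
    then have "t * (c * t + 2 * (r \<bullet> r)) < 0" using t by (simp add: mult_neg_pos)
    then show False using nn[of t] by (simp add: power2_eq_square algebra_simps)
  qed
  then have "f v = l *\<^sub>R v" using fv by simp
  then show thesis using that v by auto
qed

text \<open>Split off an eigenvector and continue in its orthogonal complement, which is again invariant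
  because \<open>f\<close> is self-adjoint.\<close>

lemma selfadjoint_orthonormal_eigenbasis:
  fixes f :: "'a::euclidean_space \<Rightarrow> 'a"
  assumes f: "linear f" and sa: "\<And>x y. f x \<bullet> y = x \<bullet> f y"
    and S: "subspace S" and inv: "f ` S \<subseteq> S"
  shows "\<exists>B. B \<subseteq> S \<and> pairwise orthogonal B \<and> (\<forall>b\<in>B. norm b = 1 \<and> (\<exists>l. f b = l *\<^sub>R b)) \<and> S \<subseteq> span B"
  using S inv
proof (induction "dim S" arbitrary: S rule: less_induct)
  case less
  show ?case
  proof (cases "S = {0}")
    case True then show ?thesis by (intro exI[of _ "{}"]) auto
  next
    case False
    from rayleigh_eigenvector[OF f sa less.prems this]
    obtain v l where v: "v \<in> S" "norm v = 1" "f v = l *\<^sub>R v" .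
    have vv: "v \<bullet> v = 1" using v by (simp add: dot_square_norm)
    let ?T = "S \<inter> {x. v \<bullet> x = 0}"
    have T: "subspace ?T" using subspace_inter[OF less.prems(1) subspace_hyperplane[of v]] by simp
    have "v \<notin> ?T" using vv by simp
    then have "?T \<subset> S" using v by blast
    then have "dim ?T < dim S"
      by (intro dim_psubset) (simp add: span_eq_iff[THEN iffD2, OF T] span_eq_iff[THEN iffD2, OF less.prems(1)])
    moreover have "f ` ?T \<subseteq> ?T"
      using less.prems v by (auto simp flip: sa)
    ultimately obtain B where B: "B \<subseteq> ?T" "pairwise orthogonal B"
      "\<forall>b\<in>B. norm b = 1 \<and> (\<exists>l. f b = l *\<^sub>R b)" "?T \<subseteq> span B"
      using less.hyps[OF _ T] by blast
    have "S \<subseteq> span (insert v B)"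
    proof
      fix x assume x: "x \<in> S"
      have "x - (v \<bullet> x) *\<^sub>R v \<in> ?T"
        using x v less.prems vv by (auto intro!: subspace_diff subspace_scale simp: inner_diff)
      then have "x - (v \<bullet> x) *\<^sub>R v \<in> span (insert v B)"
        using B(4) span_mono[of B "insert v B"] by blast
      moreover have "(v \<bullet> x) *\<^sub>R v \<in> span (insert v B)"
        by (intro span_scale span_base) simp
      ultimately have "(x - (v \<bullet> x) *\<^sub>R v) + (v \<bullet> x) *\<^sub>R v \<in> span (insert v B)"
        by (rule span_add)
      then show "x \<in> span (insert v B)" by simp
    qed
    moreover have "pairwise orthogonal (insert v B)"
      using B(1,2) by (auto simp: pairwise_insert orthogonal_def inner_commute)
    ultimately show ?thesis using B v by (intro exI[of _ "insert v B"]) auto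
  qed
qed

lemma symmetric_matrix_orthonormal_eigenvectors:
  fixes A :: "real^'n::finite^'n"
  assumes "transpose A = A"
  obtains q :: "'n \<Rightarrow> real^'n" and d :: "'n \<Rightarrow> real"
  where "\<And>i j. q i \<bullet> q j = (if i = j then 1 else 0)" "\<And>i. A *v q i = d i *\<^sub>R q i"
proof -
  have sa: "(A *v x) \<bullet> y = x \<bullet> (A *v y)" for x y
    using dot_lmul_matrix[of x A y] assms by (simp flip: transpose_matrix_vector)
  obtain B where B: "pairwise orthogonal B" "\<forall>b\<in>B. norm b = 1 \<and> (\<exists>l. A *v b = l *\<^sub>R b)"
    "UNIV \<subseteq> span B"
    using selfadjoint_orthonormal_eigenbasis[OF matrix_vector_mul_linear sa subspace_UNIV] by auto
  have ind: "independent B" using B by (intro pairwise_orthogonal_independent) auto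
  then have "finite B" "card B = CARD('n)"
    using B(3) independent_imp_finite dim_unique[of B UNIV "card B"] by (auto simp: dim_UNIV)
  then obtain q where q: "bij_betw q (UNIV :: 'n set) B"
    using finite_same_card_bij by (metis finite)
  from B(2) obtain l where l: "\<forall>b\<in>B. A *v b = l b *\<^sub>R b" by metis
  show thesis
  proof
    show "q i \<bullet> q j = (if i = j then 1 else 0)" for i j
    proof -
      have "q i \<in> B" "q j \<in> B" "i \<noteq> j \<Longrightarrow> q i \<noteq> q j"
        using q by (auto simp: bij_betw_def inj_on_def)
      then show ?thesis using B(1,2) by (auto simp: pairwise_def orthogonal_def dot_square_norm)
    qed
    show "A *v q i = l (q i) *\<^sub>R q i" for i using l q by (auto simp: bij_betw_def)
  qed
qed

text \<open>Besides the determinant of a matrix itself this computes its characteristic polynomial, since the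
  eigenvectors of \<open>A\<close> are also eigenvectors of \<open>mat x - A\<close>.\<close>

lemma det_eq_prod_eigenvalues:
  fixes A :: "real^'n::finite^'n" and q :: "'n \<Rightarrow> real^'n"
  assumes q: "\<And>i j. q i \<bullet> q j = (if i = j then 1 else 0)" and A: "\<And>i. A *v q i = d i *\<^sub>R q i"
  shows "det A = (\<Prod>i\<in>UNIV. d i)"
proof -
  define Q where "Q = (\<chi> i j. q j $ i)"
  define D :: "real^'n^'n" where "D = (\<chi> i j. if i = j then d i else 0)"
  have Q: "transpose Q ** Q = mat 1"
    using q by (auto simp: Q_def transpose_def matrix_matrix_mult_def mat_def vec_eq_iff inner_vec_def)
  have AQ: "A ** Q = Q ** D"
  proof -
    have "(A ** Q) $ i $ j = (A *v q j) $ i" for i j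
      by (simp add: matrix_matrix_mult_def matrix_vector_mult_def Q_def)
    then show ?thesis
      by (simp add: vec_eq_iff A) (simp add: matrix_matrix_mult_def Q_def D_def if_distrib[of "\<lambda>x. _ * x"] mult.commute cong: if_cong)
  qed
  have "det A * det Q = det Q * det D" using AQ by (metis det_mul)
  moreover have "det Q \<noteq> 0" using Q by (metis det_I det_mul mult_zero_right zero_neq_one)
  ultimately have "det A = det D" by simp
  also have "\<dots> = (\<Prod>i\<in>UNIV. d i)" by (subst det_diagonal) (auto simp: D_def)
  finally show ?thesis .
qed

lemma poly_charpoly: "poly (charpoly A) x = det (mat x - A)" for A :: "real^'n::finite^'n"
proof -
  have "poly ((mat [:0, 1:] - map_matrix (\<lambda>c. [:c:]) A) $ i $ j) x = (mat x - A) $ i $ j" for i j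
    by (simp add: mat_def map_matrix_def)
  then show ?thesis
    unfolding charpoly_def det_def by (simp add: poly_sum poly_prod)
qed

lemma order_prod_linear:
  assumes "finite I"
  shows "order x (\<Prod>i\<in>I. [:- d i, 1:]) = card {i \<in> I. d i = (x::real)}"
  using assms
proof (induction I rule: finite_induct)
  case (insert i I)
  have "{j \<in> insert i I. d j = x} = (if d i = x then insert i {j \<in> I. d j = x} else {j \<in> I. d j = x})"
    by auto
  moreover have "order x [:- d i, 1:] = (if d i = x then 1 else 0)"
    using order_power_n_n[of x 1] by (auto intro: order_0I)
  moreover have "[:- d i, 1:] * (\<Prod>i\<in>I. [:- d i, 1:]) \<noteq> 0"
    using insert by (simp add: del: mult_pCons_left)
  ultimately show ?case using insert
    by (simp add: order_mult del: mult_pCons_left)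
qed auto

lemma symmetric_mult_eq_0_commute:
  fixes A P :: "real^'n::finite^'n"
  assumes "transpose A = A" "transpose P = P" "A ** P = 0"
  shows "P ** A = 0"
proof -
  have "P ** A = transpose (A ** P)" by (simp only: matrix_transpose_mul assms(1,2))
  also have "\<dots> = 0" unfolding assms(3) by (simp add: transpose_def vec_eq_iff)
  finally show ?thesis .
qed

lemma matrix_add_rdistrib: "(A + B) ** C = A ** C + B ** C" for A B C :: "real^'n::finite^'n"
  by (simp add: matrix_matrix_mult_def vec_eq_iff sum.distrib algebra_simps)

text \<open>The assumptions say that \<open>P\<close> is the orthogonal projection to the kernel of \<open>A\<close>. An orthonormal
  eigenbasis of \<open>A\<close> is then one of \<open>A + P\<close>, with each eigenvalue zero replaced by one. This turns
  the product of the positive eigenvalues, which is defined through roots of a polynomial, into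
  a polynomial in the entries of \<open>A\<close>.\<close>

lemma pos_eigenvalues_prod_eq_det:
  fixes A :: "real^'n::finite^'n"
  assumes sym: "transpose A = A" and psd: "\<And>x. x \<bullet> (A *v x) \<ge> 0"
    and ker: "\<And>x. A *v x = 0 \<Longrightarrow> P *v x = x"
    and P: "transpose P = P" "A ** P = 0"
  shows "pos_eigenvalues_prod A = det (A + P)" "pos_eigenvalues_prod A > 0"
proof -
  obtain q :: "'n \<Rightarrow> real^'n" and d where q: "\<And>i j. q i \<bullet> q j = (if i = j then 1 else 0)" and A: "\<And>i. A *v q i = d i *\<^sub>R q i"
    using symmetric_matrix_orthonormal_eigenvectors[OF sym] by blast
  have d0: "d i \<ge> 0" for i using psd[of "q i"] by (simp add: A q)
  have PA: "P ** A = 0" by (rule symmetric_mult_eq_0_commute[OF sym P])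
  have Pq: "P *v q i = (if d i = 0 then q i else 0)" for i
  proof (cases "d i = 0")
    case True then show ?thesis using ker A by simp
  next
    case False
    have "d i *\<^sub>R (P *v q i) = P *v (A *v q i)" by (simp add: A matrix_vector_mult_scaleR)
    also have "\<dots> = 0" by (simp add: matrix_vector_mul_assoc PA)
    finally show ?thesis using False by simp
  qed
  have "det (A + P) = (\<Prod>i\<in>UNIV. if d i = 0 then 1 else d i)"
    by (rule det_eq_prod_eigenvalues[OF q]) (simp add: matrix_vector_mult_add_rdistrib A Pq)
  also have "\<dots> = (\<Prod>i | d i > 0. d i)"
    using d0 by (intro prod.mono_neutral_cong_right) (auto simp: less_le)
  finally have det: "det (A + P) = (\<Prod>i | d i > 0. d i)" .
  have cp: "charpoly A = (\<Prod>i\<in>UNIV. [:- d i, 1:])"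
  proof -
    have "poly (charpoly A) x = poly (\<Prod>i\<in>UNIV. [:- d i, 1:]) x" for x
    proof -
      have "det (mat x - A) = (\<Prod>i\<in>UNIV. x - d i)"
      proof (rule det_eq_prod_eigenvalues[OF q])
        have "mat x *v y = x *\<^sub>R y" for y :: "real^'n"
          by (simp add: vec_eq_iff matrix_vector_mult_def mat_def if_distrib[of "\<lambda>c. c * _"] cong: if_cong)
        then show "(mat x - A) *v q i = (x - d i) *\<^sub>R q i" for i
          by (simp add: matrix_vector_mult_diff_rdistrib A scaleR_left_diff_distrib)
      qed
      then show ?thesis by (simp add: poly_charpoly poly_prod)
    qed
    then show ?thesis by (simp add: poly_eq_poly_eq_iff[symmetric] fun_eq_iff)
  qed
  have roots: "{x. poly (charpoly A) x = 0 \<and> x > 0} = d ` {i. d i > 0}"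
    by (auto simp: cp poly_prod)
  have "pos_eigenvalues_prod A = (\<Prod>x\<in>d ` {i. d i > 0}. \<Prod>i | i \<in> {i. d i > 0} \<and> d i = x. d i)"
    unfolding pos_eigenvalues_prod_def roots unfolding cp order_prod_linear[OF finite]
  proof (rule prod.cong[OF refl])
    fix x assume "x \<in> d ` {i. 0 < d i}"
    then have "{i \<in> UNIV. d i = x} = {i \<in> {i. d i > 0}. d i = x}" by auto
    then show "x ^ card {i \<in> UNIV. d i = x} = (\<Prod>i | i \<in> {i. d i > 0} \<and> d i = x. d i)"
      by (simp del: UNIV_I)
  qed
  also have "\<dots> = (\<Prod>i | d i > 0. d i)"
    by (rule prod.image_gen[symmetric]) simp
  finally have eq: "pos_eigenvalues_prod A = (\<Prod>i | d i > 0. d i)" .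
  show "pos_eigenvalues_prod A = det (A + P)" using eq det by simp
  show "pos_eigenvalues_prod A > 0" unfolding eq by (rule prod_pos) simp
qed

text \<open>Both \<open>A ** B\<close> and \<open>A ** C\<close> are symmetric with \<open>(A ** C) ** (A ** B) = A ** B\<close>; transposing shows
  that they agree, and likewise for the products in the other order.\<close>

lemma moore_penrose_unique:
  fixes A :: "real^'n::finite^'n"
  assumes B: "A ** B ** A = A" "B ** A ** B = B" "transpose (A ** B) = A ** B" "transpose (B ** A) = B ** A"
    and C: "A ** C ** A = A" "C ** A ** C = C" "transpose (A ** C) = A ** C" "transpose (C ** A) = C ** A"
  shows "B = C"
proof -
  have "A ** B = (A ** C) ** (A ** B)" using C(1) by (simp add: matrix_mul_assoc)
  also have "\<dots> = transpose ((A ** B) ** (A ** C))" by (simp only: matrix_transpose_mul[of "A ** B"] B C)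
  also have "(A ** B) ** (A ** C) = A ** C" using B(1) by (simp add: matrix_mul_assoc)
  finally have 1: "A ** B = A ** C" using C by simp
  have "B ** A = (B ** A) ** (C ** A)" using C(1) by (simp flip: matrix_mul_assoc)
  also have "\<dots> = transpose ((C ** A) ** (B ** A))" by (simp only: matrix_transpose_mul[of "C ** A"] B C)
  also have "(C ** A) ** (B ** A) = C ** A" using B(1) by (simp flip: matrix_mul_assoc)
  finally have 2: "B ** A = C ** A" using C by simp
  have "B = B ** A ** B" using B by simp
  also have "\<dots> = C ** A ** C" using 1 2 by (metis matrix_mul_assoc)
  finally show ?thesis using C by simp
qed

text \<open>The matrix \<open>(A + P)\<^sup>-\<^sup>1 - P\<close> satisfies the four Moore-Penrose equations.\<close>

lemma mult_pseudo_inverse: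
  fixes A :: "real^'n::finite^'n"
  assumes sym: "transpose A = A" and P: "transpose P = P" "A ** P = 0" "P ** P = P"
    and det: "det (A + P) \<noteq> 0"
  shows "A ** pseudo_inverse A = mat 1 - P"
proof -
  obtain N where N: "N ** (A + P) = mat 1" "(A + P) ** N = mat 1"
    using det by (metis invertible_def invertible_det_nz)
  have PA: "P ** A = 0" by (rule symmetric_mult_eq_0_commute[OF sym P(1,2)])
  have "(A + P) ** P = P" by (simp add: matrix_add_rdistrib P)
  then have NP: "N ** P = P" using N by (metis matrix_mul_assoc matrix_mul_lid)
  have "P ** (A + P) = P" by (simp add: matrix_add_ldistrib P PA)
  then have PN: "P ** N = P" using N by (metis matrix_mul_assoc matrix_mul_rid)
  let ?B = "N - P"
  have sub1: "(X - Y) ** Z = X ** Z - Y ** Z" and sub2: "Z ** (X - Y) = Z ** X - Z ** Y" for X Y Z :: "real^'n^'n"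
    by (simp_all add: matrix_matrix_mult_def vec_eq_iff sum_subtractf algebra_simps)
  have AN: "A ** N = mat 1 - P" using N(2) PN by (metis add_diff_cancel_right' matrix_add_rdistrib)
  have NA: "N ** A = mat 1 - P" using N(1) NP by (metis add_diff_cancel_right' matrix_add_ldistrib)
  have AB: "A ** ?B = mat 1 - P" by (simp add: sub2 AN P)
  have BA: "?B ** A = mat 1 - P" by (simp add: sub1 NA PA)
  have tr: "transpose (mat 1 - P) = mat 1 - P"
    using P(1) by (simp add: transpose_def vec_eq_iff mat_def)
  have B: "A ** ?B ** A = A \<and> ?B ** A ** ?B = ?B \<and>
     transpose (A ** ?B) = A ** ?B \<and> transpose (?B ** A) = ?B ** A"
    unfolding AB BA by (simp add: tr sub1 sub2 PA PN P)
  have "pseudo_inverse A = ?B"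
    unfolding pseudo_inverse_def
  proof (rule the_equality)
    show "A ** ?B ** A = A \<and> ?B ** A ** ?B = ?B \<and>
     transpose (A ** ?B) = A ** ?B \<and> transpose (?B ** A) = ?B ** A" by (rule B)
    show "C = ?B" if "A ** C ** A = A \<and> C ** A ** C = C \<and>
     transpose (A ** C) = A ** C \<and> transpose (C ** A) = C ** A" for C
      using moore_penrose_unique[of A C ?B] that B by blast
  qed
  then show ?thesis by (simp add: AB)
qed

section \<open>The graph Laplacian\<close>

text \<open>An open neighbourhood of the simplex on which the Laplacian keeps its spectral properties.\<close>

definition pos_orthant :: "(real^'n::finite) set" where
  "pos_orthant = {x. \<forall>i. x $ i > 0}"

text \<open>The orthogonal projection to the constant vectors.\<close>

definition mean_matrix :: "real^'n::finite^'n" where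
  "mean_matrix = (\<chi> i j. 1 / real CARD('n))"

lemma open_pos_orthant: "open (pos_orthant :: (real^'n::finite) set)"
proof -
  have "pos_orthant = (\<Inter>i. {x :: real^'n. x $ i > 0})" by (auto simp: pos_orthant_def)
  moreover have "open {x :: real^'n. x $ i > 0}" for i
    by (intro open_Collect_less continuous_intros)
  ultimately show ?thesis by (metis (mono_tags, lifting) finite open_INT)
qed

lemma simplex_pos_eq: "simplex_pos = {x. (\<Sum>i\<in>UNIV. x $ i) = 1} \<inter> pos_orthant"
  by (auto simp: simplex_pos_def pos_orthant_def)

lemma simplex_subset_orthant: "simplex_pos \<subseteq> pos_orthant"
  by (auto simp: simplex_pos_eq)

lemma theta_commute: "theta a i j = theta a j i"
  by (simp add: theta_def)

lemma mean_matrix_mult: "(mean_matrix *v x) $ i = (\<Sum>j\<in>UNIV. x $ j) / real CARD('n)" for x :: "real^'n::finite"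
  by (simp add: matrix_vector_mult_def mean_matrix_def sum_divide_distrib)

lemma mean_matrix_symmetric: "transpose mean_matrix = mean_matrix"
  by (simp add: transpose_def mean_matrix_def)

lemma mean_matrix_idem: "mean_matrix ** mean_matrix = mean_matrix"
  by (simp add: matrix_matrix_mult_def mean_matrix_def)

context
  fixes E :: "('n::finite \<times> 'n) set" and \<omega> :: "'n \<Rightarrow> 'n \<Rightarrow> real"
  assumes graph: "connected_weighted_graph E \<omega>"
begin

lemma weight_commute: "\<omega> i j = \<omega> j i" and weight_nonneg: "\<omega> i j \<ge> 0"
  and weight_outside: "(i, j) \<notin> E \<Longrightarrow> \<omega> i j = 0"
  and weight_pos: "(i, j) \<in> E \<Longrightarrow> \<omega> i j > 0"
  using graph by (auto simp: connected_weighted_graph_def) (metis less_eq_real_def)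

lemma sum_nbhd: "(\<Sum>j\<in>nbhd E i. \<omega> i j * f j) = (\<Sum>j\<in>UNIV. \<omega> i j * f j)"
  by (rule sum.mono_neutral_left) (auto simp: nbhd_def weight_outside)

lemma Lap_entry:
  "Lap E \<omega> a $ i $ j = (if i = j then \<Sum>k\<in>UNIV. \<omega> i k * theta a i k else 0) - \<omega> i j * theta a i j"
proof -
  have "Lap E \<omega> a $ i $ j
      = (\<Sum>k\<in>UNIV. \<omega> i k * (theta a i k * (axis j 1 $ i - axis j 1 $ k)))"
    by (simp add: Lap_def matrix_def mult.assoc sum_nbhd)
  also have "\<dots> = (\<Sum>k\<in>UNIV. (if i = j then \<omega> i k * theta a i k else 0) - (if k = j then \<omega> i k * theta a i k else 0))"
    by (intro sum.cong) (auto simp: axis_def)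
  finally show ?thesis by (simp add: sum_subtractf)
qed

lemma Lap_mult: "(Lap E \<omega> a *v x) $ i = (\<Sum>j\<in>UNIV. \<omega> i j * theta a i j * (x $ i - x $ j))"
proof -
  have "(Lap E \<omega> a *v x) $ i
      = (\<Sum>j\<in>UNIV. (if i = j then (\<Sum>k\<in>UNIV. \<omega> i k * theta a i k) * x $ j else 0) - \<omega> i j * theta a i j * x $ j)"
    unfolding matrix_vector_mult_def by (auto simp: Lap_entry algebra_simps intro!: sum.cong)
  then show ?thesis
    by (simp add: sum_subtractf sum_distrib_right right_diff_distrib)
qed

lemma Lap_symmetric: "transpose (Lap E \<omega> a) = Lap E \<omega> a"
proof -
  have "Lap E \<omega> a $ j $ i = Lap E \<omega> a $ i $ j" for i j
    unfolding Lap_entry weight_commute[of j i] theta_commute[of a j i] by auto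
  then show ?thesis by (simp add: transpose_def vec_eq_iff)
qed

lemma Lap_mult_sum: "(\<Sum>i\<in>UNIV. (Lap E \<omega> a *v x) $ i) = 0"
proof -
  have "(\<Sum>i\<in>UNIV. (Lap E \<omega> a *v x) $ i) = - (\<Sum>i\<in>UNIV. (Lap E \<omega> a *v x) $ i)"
    unfolding Lap_mult sum_negf[symmetric]
    by (subst sum.swap, intro sum.cong refl, subst weight_commute, subst theta_commute)
      (simp add: right_diff_distrib)
  then show ?thesis by simp
qed

text \<open>Symmetrising the double sum exhibits the quadratic form as a sum of squares over the edges, hence
  nonnegative for positive \<open>a\<close>.\<close>

lemma Lap_form:
  "x \<bullet> (Lap E \<omega> a *v x) = (\<Sum>i\<in>UNIV. \<Sum>j\<in>UNIV. \<omega> i j * theta a i j * (x $ i - x $ j)\<^sup>2) / 2"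
proof -
  let ?S = "\<Sum>i\<in>UNIV. \<Sum>j\<in>UNIV. \<omega> i j * theta a i j * (x $ i - x $ j) * x $ i"
  have 1: "x \<bullet> (Lap E \<omega> a *v x) = ?S"
    by (simp add: inner_vec_def Lap_mult sum_distrib_left ac_simps)
  have 2: "?S = (\<Sum>i\<in>UNIV. \<Sum>j\<in>UNIV. \<omega> i j * theta a i j * (x $ j - x $ i) * x $ j)"
    by (subst sum.swap, intro sum.cong refl, subst weight_commute, subst theta_commute, rule refl)
  have "?S + ?S = (\<Sum>i\<in>UNIV. \<Sum>j\<in>UNIV. \<omega> i j * theta a i j * (x $ i - x $ j)\<^sup>2)"
    by (subst (2) 2) (simp add: sum.distrib[symmetric] algebra_simps power2_eq_square)
  with 1 show ?thesis by simp
qed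

lemma theta_pos: "a \<in> pos_orthant \<Longrightarrow> theta a i j > 0"
  by (simp add: pos_orthant_def theta_def add_pos_pos)

lemma Lap_psd: "a \<in> pos_orthant \<Longrightarrow> x \<bullet> (Lap E \<omega> a *v x) \<ge> 0"
  unfolding Lap_form
  by (intro divide_nonneg_nonneg sum_nonneg mult_nonneg_nonneg weight_nonneg less_imp_le[OF theta_pos]) auto

text \<open>Each square in the quadratic form vanishes, so \<open>x\<close> takes the same value at adjacent vertices, and
  connectedness propagates this to all vertices.\<close>

lemma Lap_kernel:
  assumes a: "a \<in> pos_orthant" and x: "Lap E \<omega> a *v x = 0"
  shows "x $ i = x $ j"
proof -
  have nn: "\<omega> i j * theta a i j * (x $ i - x $ j)\<^sup>2 \<ge> 0" for i j
    using a by (intro mult_nonneg_nonneg weight_nonneg less_imp_le[OF theta_pos]) auto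
  have "(\<Sum>i\<in>UNIV. \<Sum>j\<in>UNIV. \<omega> i j * theta a i j * (x $ i - x $ j)\<^sup>2) = 0"
    using Lap_form[of x a] x by simp
  then have "\<omega> i j * theta a i j * (x $ i - x $ j)\<^sup>2 = 0" for i j
    using nn by (simp add: sum_nonneg_eq_0_iff sum_nonneg)
  then have edge: "(i, j) \<in> E \<Longrightarrow> x $ i = x $ j" for i j
    using weight_pos[of i j] theta_pos[OF a, of i j] by (metis less_irrefl mult_eq_0_iff power_eq_0_iff right_minus_eq)
  have "(i, j) \<in> E\<^sup>*" using graph by (simp add: connected_weighted_graph_def)
  then show ?thesis by (induction rule: rtrancl_induct) (use edge in auto)
qed

lemma Lap_mean_matrix: "Lap E \<omega> a ** mean_matrix = 0"
  by (simp add: matrix_matrix_mult_def mean_matrix_def vec_eq_iff Lap_entry sum_subtractf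
      flip: sum_divide_distrib)

lemma Pi_ev_eq_det:
  assumes a: "a \<in> pos_orthant"
  shows "Pi_ev E \<omega> a = det (Lap E \<omega> a + mean_matrix)" "Pi_ev E \<omega> a > 0"
proof -
  have ker: "mean_matrix *v x = x" if "Lap E \<omega> a *v x = 0" for x
  proof -
    have "(mean_matrix *v x) $ i = x $ i" for i
    proof -
      have "(\<Sum>j\<in>UNIV. x $ j) = (\<Sum>j\<in>(UNIV :: 'n set). x $ i)"
        by (rule sum.cong[OF refl]) (rule Lap_kernel[OF a that])
      then show ?thesis by (simp add: mean_matrix_mult)
    qed
    then show ?thesis by (simp add: vec_eq_iff)
  qed
  show "Pi_ev E \<omega> a = det (Lap E \<omega> a + mean_matrix)" "Pi_ev E \<omega> a > 0"
    unfolding Pi_ev_def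
    using pos_eigenvalues_prod_eq_det[OF Lap_symmetric Lap_psd[OF a] ker mean_matrix_symmetric Lap_mean_matrix]
    by auto
qed

lemma smooth_on_Lap_entry: "open U \<Longrightarrow> smooth_on U (\<lambda>a. Lap E \<omega> a $ i $ j)"
proof -
  assume U: "open U"
  have "smooth_on U (\<lambda>a. theta a i k)" for k
    unfolding theta_def divide_inverse by (intro smooth_on_intros U)
  then show ?thesis
    unfolding Lap_entry by (cases "i = j") (simp_all only: if_True if_False, (intro smooth_on_intros U; simp)+)
qed

lemma smooth_on_Pi_ev: "smooth_on pos_orthant (Pi_ev E \<omega>)"
proof -
  have "smooth_on pos_orthant (\<lambda>a. det (Lap E \<omega> a + mean_matrix))"
    unfolding det_def vector_add_component
    by (intro smooth_on_intros open_pos_orthant smooth_on_Lap_entry)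
  then show ?thesis
    by (subst smooth_on_cong[OF open_pos_orthant, of _ "\<lambda>a. det (Lap E \<omega> a + mean_matrix)"])
      (auto simp: Pi_ev_eq_det(1))
qed

text \<open>The metric cancels against the Laplacian in the gradient, up to the projection to the vectors with
  sum zero, which fixes \<open>\<sigma>\<close>.\<close>

lemma gW_gradW:
  assumes \<rho>: "\<rho> \<in> pos_orthant" and \<sigma>: "(\<Sum>i\<in>UNIV. \<sigma> $ i) = 0"
  shows "gW E \<omega> \<rho> (gradW E \<omega> F \<rho>) \<sigma> = egrad F \<rho> \<bullet> \<sigma>"
proof -
  let ?L = "Lap E \<omega> \<rho>"
  have "gW E \<omega> \<rho> (gradW E \<omega> F \<rho>) \<sigma> = egrad F \<rho> \<bullet> (?L *v (pseudo_inverse ?L *v \<sigma>))"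
    using dot_lmul_matrix[of "egrad F \<rho>" ?L] Lap_symmetric[of \<rho>]
    by (simp add: gW_def gradW_def flip: transpose_matrix_vector)
  also have "?L *v (pseudo_inverse ?L *v \<sigma>) = (mat 1 - mean_matrix) *v \<sigma>"
    using mult_pseudo_inverse[OF Lap_symmetric mean_matrix_symmetric Lap_mean_matrix mean_matrix_idem] Pi_ev_eq_det[OF \<rho>]
    by (simp add: matrix_vector_mul_assoc)
  also have "\<dots> = \<sigma>"
    by (simp add: matrix_vector_mult_diff_rdistrib) (simp add: vec_eq_iff mean_matrix_mult \<sigma>)
  finally show ?thesis .
qed

end

section \<open>Integration over the simplex\<close>

lemma proj_hyp_sum: "(\<Sum>i\<in>UNIV. proj_hyp x $ i) = 1"
  by (simp add: proj_hyp_def sum.distrib)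

lemma proj_hyp_translate:
  "(\<Sum>i\<in>UNIV. v $ i) = 0 \<Longrightarrow> proj_hyp (x + t *\<^sub>R v) = proj_hyp x + t *\<^sub>R v"
  by (simp add: proj_hyp_def vec_eq_iff sum.distrib flip: sum_distrib_left)

lemma continuous_on_proj_hyp: "continuous_on S proj_hyp"
  unfolding proj_hyp_def by (intro continuous_intros) auto

text \<open>The points whose normal coordinate lies in the range of the unit prism; unlike the prism, this
  set is invariant under all translations parallel to the simplex.\<close>

definition slab :: "(real^'n::finite) set" where
  "slab = {x. (\<Sum>j\<in>UNIV. x $ j) / sqrt (real CARD('n)) \<in> {0..1}}"

lemma unit_prism_eq: "unit_prism = proj_hyp -` simplex_pos \<inter> slab"
  by (auto simp: unit_prism_def slab_def)

lemma slab_translate: "(\<Sum>i\<in>UNIV. v $ i) = 0 \<Longrightarrow> x + t *\<^sub>R v \<in> slab \<longleftrightarrow> x \<in> slab"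
  by (simp add: slab_def sum.distrib flip: sum_distrib_left)

lemma proj_hyp_borel [measurable]: "proj_hyp \<in> borel_measurable borel"
  by (rule borel_measurable_continuous_onI[OF continuous_on_proj_hyp])

lemma slab_borel [measurable]: "slab \<in> sets borel"
proof -
  have "slab = (\<lambda>x::real^'a. (\<Sum>j\<in>UNIV. x $ j) / sqrt (real CARD('a))) -` {0..1}"
    by (auto simp: slab_def)
  moreover have "closed \<dots>"
    by (intro continuous_closed_vimage closed_atLeastAtMost continuous_intros) auto
  ultimately show ?thesis by simp
qed

lemma closed_hyperplane_sum: "closed {x :: real^'n::finite. (\<Sum>i\<in>UNIV. x $ i) = 1}"
  by (intro closed_Collect_eq continuous_intros)

lemma simplex_borel [measurable]: "simplex_pos \<in> sets borel"
  unfolding simplex_pos_eq by (intro sets.Int borel_open borel_closed open_pos_orthant closed_hyperplane_sum)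

lemma unit_prism_borel [measurable]: "unit_prism \<in> sets borel"
  unfolding unit_prism_eq by (metis (no_types) Int_UNIV_right measurable_sets proj_hyp_borel sets.Int simplex_borel slab_borel space_borel)

lemma proj_hyp_measurable:
  "proj_hyp \<in> restrict_space lborel unit_prism \<rightarrow>\<^sub>M restrict_space borel simplex_pos"
  by (intro measurable_restrict_space2 measurable_restrict_space1)
    (auto simp: space_restrict_space unit_prism_def)

lemma space_vol_euclid [simp]: "space vol_euclid = simplex_pos"
  and sets_vol_euclid [measurable_cong]: "sets vol_euclid = sets (restrict_space borel simplex_pos)"
  by (simp_all add: vol_euclid_def space_restrict_space)

lemma continuous_on_imp_measurable_vol:
  "continuous_on simplex_pos f \<Longrightarrow> f \<in> borel_measurable vol_euclid"
  unfolding measurable_cong_sets[OF sets_vol_euclid refl] by (rule borel_measurable_continuous_on_restrict)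

lemma integral_vol_euclid:
  fixes f :: "real^'n::finite \<Rightarrow> real"
  assumes "f \<in> borel_measurable vol_euclid"
  shows "integral\<^sup>L vol_euclid f = (LINT x|lborel. indicator unit_prism x * f (proj_hyp x))"
proof -
  have "integral\<^sup>L vol_euclid f = integral\<^sup>L (restrict_space lborel unit_prism) (\<lambda>x. f (proj_hyp x))"
    unfolding vol_euclid_def using assms
    by (intro integral_distr proj_hyp_measurable) (simp add: measurable_cong_sets[OF sets_vol_euclid refl])
  also have "\<dots> = (LINT x|lborel. indicator unit_prism x *\<^sub>R f (proj_hyp x))"
    by (rule integral_restrict_space) simp
  finally show ?thesis by simp
qed

text \<open>The projection loses only the normal coordinate, which is bounded on the slab. This is why compact
  support on the simplex is enough for integrability over the prism.\<close>

lemma bounded_over_slab: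
  fixes S :: "(real^'n::finite) set"
  assumes "bounded S"
  shows "bounded {x \<in> slab. proj_hyp x \<in> S}"
proof -
  obtain B where B: "\<And>x. x \<in> S \<Longrightarrow> norm x \<le> B" using assms by (auto simp: bounded_iff)
  have "norm x \<le> (\<Sum>i\<in>(UNIV::'n set). B + (1 + sqrt (real CARD('n))))" if "x \<in> slab" "proj_hyp x \<in> S" for x
  proof -
    have n: "real CARD('n) \<ge> 1" by (simp add: Suc_leI)
    let ?s = "\<Sum>j\<in>UNIV. x $ j"
    have s: "0 \<le> ?s" "?s \<le> sqrt (real CARD('n))"
      using that(1) n by (auto simp: slab_def zero_le_divide_iff divide_le_eq)
    have "\<bar>(1 - ?s) / real CARD('n)\<bar> \<le> \<bar>1 - ?s\<bar> / 1"
      unfolding abs_divide using n by (intro divide_left_mono) auto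
    also have "\<dots> \<le> 1 + sqrt (real CARD('n))" using s by (simp add: abs_le_iff)
    finally have c: "\<bar>(1 - ?s) / real CARD('n)\<bar> \<le> 1 + sqrt (real CARD('n))" .
    have "\<bar>x $ i\<bar> \<le> B + (1 + sqrt (real CARD('n)))" for i
    proof -
      have "proj_hyp x $ i = x $ i + (1 - ?s) / real CARD('n)" by (simp add: proj_hyp_def)
      then show ?thesis using component_le_norm_cart[of "proj_hyp x" i] B[OF that(2)] c by linarith
    qed
    then have "(\<Sum>i\<in>UNIV. \<bar>x $ i\<bar>) \<le> (\<Sum>i\<in>(UNIV::'n set). B + (1 + sqrt (real CARD('n))))"
      by (intro sum_mono)
    then show ?thesis using norm_le_l1_cart[of x] by linarith
  qed
  then show ?thesis by (auto simp: bounded_iff)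
qed

lemma bounded_simplex: "bounded (simplex_pos :: (real^'n::finite) set)"
proof -
  have "norm x \<le> 1" if "x \<in> simplex_pos" for x :: "real^'n"
    using norm_le_l1_cart[of x] that by (simp add: simplex_pos_def less_imp_le)
  then show ?thesis by (auto simp: bounded_iff)
qed

lemma finite_measure_vol_euclid: "finite_measure (vol_euclid :: (real^'n::finite) measure)"
proof
  have "bounded (unit_prism :: (real^'n) set)"
    by (rule bounded_subset[OF bounded_over_slab[OF bounded_simplex]]) (auto simp: unit_prism_eq)
  then have "emeasure lborel (unit_prism :: (real^'n) set) < \<infinity>"
    by (rule emeasure_bounded_finite)
  moreover have "proj_hyp -` simplex_pos \<inter> unit_prism = (unit_prism :: (real^'n) set)"
    by (auto simp: unit_prism_eq)
  ultimately show "emeasure vol_euclid (space (vol_euclid :: (real^'n) measure)) \<noteq> \<infinity>"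
    unfolding space_vol_euclid unfolding vol_euclid_def
    by (subst emeasure_distr[OF proj_hyp_measurable])
      (auto simp: space_restrict_space emeasure_restrict_space sets_restrict_space)
qed

lemma integrable_vol_euclid:
  fixes f :: "real^'n::finite \<Rightarrow> real"
  assumes f: "continuous_on simplex_pos f" and K: "compact K" "K \<subseteq> simplex_pos"
    and zero: "\<And>x. x \<in> simplex_pos - K \<Longrightarrow> f x = 0"
  shows "integrable vol_euclid f"
proof -
  interpret finite_measure "vol_euclid :: (real^'n) measure" by (rule finite_measure_vol_euclid)
  have "compact (f ` K)" using f K by (intro compact_continuous_image continuous_on_subset[OF f])
  then have "bounded (f ` K)" by (rule compact_imp_bounded)
  then obtain B where "\<And>x. x \<in> K \<Longrightarrow> \<bar>f x\<bar> \<le> B" by (auto simp: bounded_iff)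
  then have "AE x in vol_euclid. norm (f x) \<le> max B 0"
    using zero by (intro AE_I2) (force simp: le_max_iff_disj)
  then show ?thesis
    by (rule integrable_const_bound[OF _ continuous_on_imp_measurable_vol[OF f]])
qed

lemma integrable_vol_euclid_lborel:
  fixes f :: "real^'n::finite \<Rightarrow> real"
  assumes "integrable vol_euclid f"
  shows "integrable lborel (\<lambda>x. indicator unit_prism x * f (proj_hyp x))"
proof -
  have "integrable (restrict_space lborel unit_prism) (\<lambda>x. f (proj_hyp x))"
    using assms unfolding vol_euclid_def
    by (subst (asm) integrable_distr_eq[OF proj_hyp_measurable])
      (use borel_measurable_integrable[OF assms] in \<open>simp_all add: measurable_cong_sets[OF sets_vol_euclid refl]\<close>)
  then show ?thesis
    by (subst (asm) integrable_restrict_space) simp_all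
qed

lemma integral_lborel_translate:
  fixes f :: "'a::euclidean_space \<Rightarrow> real"
  assumes "integrable lborel f"
  shows "integrable lborel (\<lambda>x. f (x + c))" "(LINT x|lborel. f (x + c)) = integral\<^sup>L lborel f"
proof -
  have f: "f \<in> borel_measurable borel" using borel_measurable_integrable[OF assms] by simp
  show "integrable lborel (\<lambda>x. f (x + c))"
    using assms integrable_distr_eq[of "(+) c" lborel borel f] f
    by (simp add: lborel_distr_plus add.commute)
  show "(LINT x|lborel. f (x + c)) = integral\<^sup>L lborel f"
    using integral_distr[of "(+) c" lborel borel f] f
    by (simp add: lborel_distr_plus add.commute)
qed

text \<open>The function \<open>H\<close> that is \<open>g \<circ> proj_hyp\<close> on the prism and zero elsewhere has the same integral as
  its translates along \<open>v\<close>, so the difference quotients of \<open>H\<close> along \<open>v\<close> have integral zero.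
  They are bounded by a constant on a bounded set, vanish outside of it and converge to the
  derivative, so dominated convergence applies.\<close>

lemma integral_tangential_derivative_eq_0:
  fixes g :: "real^'n::finite \<Rightarrow> real"
  assumes v: "(\<Sum>i\<in>UNIV. v $ i) = 0"
    and U: "open U" "simplex_pos \<subseteq> U" and g: "smooth_on U g"
    and K: "compact K" "K \<subseteq> simplex_pos" and zero: "\<And>x. x \<in> simplex_pos - K \<Longrightarrow> g x = 0"
  shows "integrable vol_euclid (\<lambda>\<rho>. v \<bullet> egrad g \<rho>)" "(LINT \<rho>|vol_euclid. v \<bullet> egrad g \<rho>) = 0"
proof -
  let ?hyp = "{x :: real^'n. (\<Sum>i\<in>UNIV. x $ i) = 1}"
  \<comment> \<open>Extended by zero from the simplex to its hyperplane, \<open>g\<close> stays differentiable along lines.\<close>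
  define f where "f y = (if y \<in> simplex_pos then g y else 0)" for y
  define d where "d y = (if y \<in> simplex_pos then v \<bullet> egrad g y else 0)" for y
  have f0: "f y = 0" if "y \<notin> K" for y using zero that by (auto simp: f_def)
  have line_hyp: "y + t *\<^sub>R v \<in> ?hyp" if "y \<in> ?hyp" for y t
    using that v by (simp add: sum.distrib flip: sum_distrib_left)
  have open_line: "open ((\<lambda>t. y + t *\<^sub>R v) -` W)" if "open W" for y and W :: "(real^'n) set"
    by (intro continuous_open_vimage that continuous_intros)
  have "closed K" using K(1) compact_imp_closed by blast
  have Dzero: "((\<lambda>t. f (y + t *\<^sub>R v)) has_real_derivative 0) (at t)" if "y + t *\<^sub>R v \<notin> K" for y t
  proof (rule has_field_derivative_transform_within_open[OF DERIV_const open_line[of "- K"]])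
    show "open (- K)" using \<open>closed K\<close> by auto
  qed (use that f0 in auto)
  have D: "((\<lambda>t. f (y + t *\<^sub>R v)) has_real_derivative d (y + t *\<^sub>R v)) (at t)" if y: "y \<in> ?hyp" for y t
  proof (cases "y + t *\<^sub>R v \<in> simplex_pos")
    case True
    then have "g differentiable (at (y + t *\<^sub>R v))"
      using smooth_on_differentiable[OF g U(1)] U(2) by blast
    from has_real_derivative_along_line[OF this]
    have "((\<lambda>t. g (y + t *\<^sub>R v)) has_real_derivative d (y + t *\<^sub>R v)) (at t)"
      using True by (simp add: d_def)
    then show ?thesis
      by (rule has_field_derivative_transform_within_open[OF _ open_line[OF open_pos_orthant]])
        (use True line_hyp[OF y] in \<open>auto simp: f_def simplex_pos_eq\<close>)
  next
    case False
    then show ?thesis using Dzero[of y t] K(2) by (auto simp: d_def)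
  qed
  have d0: "d y = 0" if "y \<notin> K" for y
  proof (cases "y \<in> simplex_pos")
    case True
    then have "y \<in> ?hyp" by (simp add: simplex_pos_def)
    from D[OF this, of 0] Dzero[of y 0] that show ?thesis using DERIV_unique by force
  qed (simp add: d_def)
  have cont_g: "continuous_on simplex_pos g" and cont_dg: "continuous_on simplex_pos (\<lambda>y. v \<bullet> egrad g y)"
    using smooth_on_continuous_on[OF g] smooth_on_continuous_on[OF smooth_on_partial[OF g]] U(2)
    by (auto simp: inner_vec_def egrad_def intro!: continuous_intros intro: continuous_on_subset)
  obtain C where C: "\<And>y. \<bar>d y\<bar> \<le> C"
  proof -
    have "compact ((\<lambda>y. v \<bullet> egrad g y) ` K)"
      using K by (intro compact_continuous_image continuous_on_subset[OF cont_dg])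
    then have "bounded ((\<lambda>y. v \<bullet> egrad g y) ` K)" by (rule compact_imp_bounded)
    then obtain B where B: "\<And>x. x \<in> K \<Longrightarrow> \<bar>v \<bullet> egrad g x\<bar> \<le> B" by (auto simp: bounded_iff)
    have "\<bar>d y\<bar> \<le> max B 0" for y
      using B[of y] d0[of y] K(2) by (cases "y \<in> K") (auto simp: d_def le_max_iff_disj)
    then show thesis by (rule that)
  qed
  have Cpos: "C \<ge> 0" using C[of 0] by linarith
  define s where "s m = 1 / (1 + real m)" for m
  have s: "s m > 0" "s m \<le> 1" for m by (auto simp: s_def)
  have s0: "s \<longlonglongrightarrow> 0" unfolding s_def by real_asymp
  define q where "q m x = indicator slab x * ((f (proj_hyp x + s m *\<^sub>R v) - f (proj_hyp x)) / s m)" for m x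
  \<comment> \<open>Outside of this set neither end point of the difference quotient meets the support.\<close>
  define S where "S = (\<lambda>(y, t). y - t *\<^sub>R v) ` (K \<times> {0..1})"
  have "compact S" unfolding S_def
    by (intro compact_continuous_image compact_Times K compact_Icc)
      (auto simp: case_prod_unfold intro!: continuous_intros)
  then have "bounded {x \<in> slab. proj_hyp x \<in> S}"
    by (intro bounded_over_slab compact_imp_bounded)
  then obtain R where R: "{x \<in> slab. proj_hyp x \<in> S} \<subseteq> cball 0 R"
    by (auto simp: bounded_iff subset_iff)
  have q_bound: "norm (q m x) \<le> C * indicator (cball 0 R) x" for m x
  proof (cases "x \<in> slab \<and> proj_hyp x \<in> S")
    case True
    have "proj_hyp x \<in> ?hyp" by (simp add: proj_hyp_sum)
    then have "\<exists>z. 0 < z \<and> z < s m \<and> f (proj_hyp x + s m *\<^sub>R v) - f (proj_hyp x + 0 *\<^sub>R v)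
        = (s m - 0) * d (proj_hyp x + z *\<^sub>R v)"
      by (intro MVT2 s D)
    then obtain z where "f (proj_hyp x + s m *\<^sub>R v) - f (proj_hyp x) = s m * d (proj_hyp x + z *\<^sub>R v)"
      by auto
    then have "q m x = d (proj_hyp x + z *\<^sub>R v)" using True s(1)[of m] by (simp add: q_def)
    then show ?thesis using C True R by (auto simp: indicator_def)
  next
    case False
    have "f (proj_hyp x + s m *\<^sub>R v) = 0 \<and> f (proj_hyp x) = 0" if "proj_hyp x \<notin> S"
    proof -
      have "(proj_hyp x + t *\<^sub>R v) \<notin> K" if "0 \<le> t" "t \<le> 1" for t
      proof
        assume "proj_hyp x + t *\<^sub>R v \<in> K"
        then have "(\<lambda>(y, t). y - t *\<^sub>R v) (proj_hyp x + t *\<^sub>R v, t) \<in> S"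
          unfolding S_def using that by (intro imageI) auto
        then show False using \<open>proj_hyp x \<notin> S\<close> by simp
      qed
      from this[of "s m"] this[of 0] show ?thesis using s[of m] f0 by (simp add: less_imp_le)
    qed
    then show ?thesis using False Cpos by (auto simp: q_def indicator_def)
  qed
  define H where "H x = indicator unit_prism x * g (proj_hyp x)" for x
  have H: "integrable lborel H"
    unfolding H_def by (intro integrable_vol_euclid_lborel integrable_vol_euclid[OF cont_g K zero])
  have q_eq: "q m x = (H (x + s m *\<^sub>R v) - H x) / s m" for m x
    by (auto simp: q_def H_def f_def unit_prism_eq proj_hyp_translate[OF v] slab_translate[OF v] indicator_def)
  have q_int: "integral\<^sup>L lborel (q m) = 0" and q_meas: "q m \<in> borel_measurable lborel" for m
  proof -
    note tr = integral_lborel_translate[OF H, of "s m *\<^sub>R v"]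
    show "integral\<^sup>L lborel (q m) = 0" unfolding q_eq by (simp add: tr H)
    show "q m \<in> borel_measurable lborel"
      unfolding q_eq using borel_measurable_integrable[OF tr(1)] borel_measurable_integrable[OF H] by measurable
  qed
  have lim: "(\<lambda>m. q m x) \<longlonglongrightarrow> indicator unit_prism x * (v \<bullet> egrad g (proj_hyp x))" for x
  proof -
    have "proj_hyp x \<in> ?hyp" by (simp add: proj_hyp_sum)
    from D[OF this, of 0] have "((\<lambda>h. (f (proj_hyp x + h *\<^sub>R v) - f (proj_hyp x)) / h) \<longlongrightarrow> d (proj_hyp x)) (at 0)"
      by (simp add: DERIV_def)
    moreover have "filterlim s (at 0) sequentially"
      using s0 s(1) by (auto simp: filterlim_at intro!: always_eventually less_imp_neq[symmetric])
    ultimately have "(\<lambda>m. (f (proj_hyp x + s m *\<^sub>R v) - f (proj_hyp x)) / s m) \<longlonglongrightarrow> d (proj_hyp x)"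
      by (rule filterlim_compose)
    then have "(\<lambda>m. q m x) \<longlonglongrightarrow> indicator slab x * d (proj_hyp x)"
      unfolding q_def by (intro tendsto_intros)
    moreover have "indicator slab x * d (proj_hyp x) = indicator unit_prism x * (v \<bullet> egrad g (proj_hyp x))"
      by (auto simp: unit_prism_eq d_def indicator_def)
    ultimately show ?thesis by simp
  qed
  have dg_meas: "(\<lambda>y. v \<bullet> egrad g y) \<in> borel_measurable vol_euclid"
    by (rule continuous_on_imp_measurable_vol[OF cont_dg])
  have "(\<lambda>m. integral\<^sup>L lborel (q m)) \<longlonglongrightarrow> (LINT x|lborel. indicator unit_prism x * (v \<bullet> egrad g (proj_hyp x)))"
  proof (rule integral_dominated_convergence[where w="\<lambda>x. C * indicator (cball 0 R) x"])
    show "integrable lborel (\<lambda>x. C * indicator (cball 0 R) x :: real)"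
      by (intro integrable_mult_right integrable_real_indicator emeasure_lborel_cball_finite) auto
    show "(\<lambda>x. indicator unit_prism x * (v \<bullet> egrad g (proj_hyp x))) \<in> borel_measurable lborel"
      by (rule borel_measurable_LIMSEQ_real[OF lim q_meas])
  qed (use lim q_bound q_meas in auto)
  then have "(LINT x|lborel. indicator unit_prism x * (v \<bullet> egrad g (proj_hyp x))) = 0"
    by (simp add: q_int LIMSEQ_const_iff)
  then show "(LINT \<rho>|vol_euclid. v \<bullet> egrad g \<rho>) = 0" by (simp add: integral_vol_euclid[OF dg_meas])
  show "integrable vol_euclid (\<lambda>\<rho>. v \<bullet> egrad g \<rho>)"
    by (rule integrable_vol_euclid[OF cont_dg K]) (use d0 in \<open>force simp: d_def\<close>)
qed

lemma test_fun_bump: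
  assumes r: "r > 0" and "cball y r \<subseteq> pos_orthant"
  shows "test_fun (bump y r)"
  unfolding test_fun_def
proof
  show "smooth_near simplex_pos (bump y r)"
    using smooth_on_bump[of y r] by (auto simp: smooth_near_def smooth_on_def intro!: exI[of _ UNIV])
  show "\<exists>K. compact K \<and> K \<subseteq> simplex_pos \<and> (\<forall>\<rho>\<in>simplex_pos - K. bump y r \<rho> = 0)"
  proof (intro exI[of _ "cball y r \<inter> {x. (\<Sum>i\<in>UNIV. x $ i) = 1}"] conjI ballI)
    show "bump y r \<rho> = 0" if "\<rho> \<in> simplex_pos - cball y r \<inter> {x. (\<Sum>i\<in>UNIV. x $ i) = 1}" for \<rho>
      using that by (intro bump_eq_0[OF r]) (auto simp: simplex_pos_def)
  qed (use assms closed_hyperplane_sum in \<open>auto simp: simplex_pos_eq intro: compact_Int_closed\<close>)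
qed

text \<open>If \<open>d y > 0\<close>, a bump function around \<open>y\<close>, positive only where \<open>d\<close> is, gives a nonnegative integrand with
  integral zero that is positive on a nonempty open set.\<close>

lemma vanishing_against_test_funs_nonpos:
  fixes d :: "real^'n::finite \<Rightarrow> real"
  assumes d: "continuous_on simplex_pos d"
    and int: "\<And>\<phi>. test_fun \<phi> \<Longrightarrow> (LINT \<rho>|vol_euclid. \<phi> \<rho> * d \<rho>) = 0"
    and y: "y \<in> simplex_pos"
  shows "d y \<le> 0"
proof (rule ccontr)
  assume "\<not> d y \<le> 0"
  then have dy: "d y > 0" by simp
  obtain r1 where r1: "r1 > 0" "\<And>x. x \<in> simplex_pos \<Longrightarrow> dist x y < r1 \<Longrightarrow> dist (d x) (d y) < d y"
    using d y dy unfolding continuous_on_iff by meson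
  obtain r2 where r2: "r2 > 0" "cball y r2 \<subseteq> pos_orthant"
    using open_pos_orthant y simplex_subset_orthant by (meson open_contains_cball subsetD)
  define r where "r = min r1 r2"
  have r: "r > 0" "cball y r \<subseteq> pos_orthant" using r1 r2 by (auto simp: r_def)
  have d_pos: "d x > 0" if "x \<in> simplex_pos" "dist y x < r" for x
    using r1(2)[OF that(1)] that(2) by (auto simp: r_def dist_commute dist_real_def abs_if split: if_splits)
  let ?\<phi> = "bump y r"
  have test: "test_fun ?\<phi>" by (rule test_fun_bump[OF r])
  then obtain K where K: "compact K" "K \<subseteq> simplex_pos" "\<And>\<rho>. \<rho> \<in> simplex_pos - K \<Longrightarrow> ?\<phi> \<rho> = 0"
    by (auto simp: test_fun_def)
  have cont: "continuous_on simplex_pos (\<lambda>\<rho>. ?\<phi> \<rho> * d \<rho>)"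
    using smooth_on_continuous_on[OF smooth_on_bump] d
    by (intro continuous_intros) (auto intro: continuous_on_subset)
  define h where "h x = indicator unit_prism x * (?\<phi> (proj_hyp x) * d (proj_hyp x))" for x
  have h_int: "integrable lborel h"
    unfolding h_def by (intro integrable_vol_euclid_lborel integrable_vol_euclid[OF cont K(1,2)]) (simp add: K(3))
  have "integral\<^sup>L lborel h = 0"
    using int[OF test] by (simp add: integral_vol_euclid[OF continuous_on_imp_measurable_vol[OF cont]] h_def[abs_def])
  moreover have "h x \<ge> 0" for x
  proof (cases "dist y (proj_hyp x) < r")
    case True then show ?thesis
      using d_pos[of "proj_hyp x"] bump_nonneg[of y r] by (auto simp: h_def indicator_def unit_prism_def less_imp_le)
  next
    case False then show ?thesis using bump_eq_0[OF r(1), of y "proj_hyp x"] by (simp add: h_def)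
  qed
  ultimately have AE: "AE x in lborel. h x = 0"
    using integral_nonneg_eq_0_iff_AE[OF h_int] by simp
  let ?t = "\<lambda>x. (\<Sum>j\<in>UNIV. x $ j) / sqrt (real CARD('n))"
  define W where "W = {x. dist y (proj_hyp x) < r} \<inter> ?t -` {0<..<1}"
  have "open W" unfolding W_def
    by (intro open_Int open_Collect_less continuous_open_vimage continuous_intros continuous_on_proj_hyp) auto
  have hW: "h x > 0" if "x \<in> W" for x
  proof -
    have "proj_hyp x \<in> simplex_pos"
      using that r(2) by (auto simp: W_def simplex_pos_eq proj_hyp_sum)
    then show ?thesis using that d_pos[of "proj_hyp x"] bump_pos_iff[OF r(1), of y "proj_hyp x"]
      by (auto simp: W_def h_def unit_prism_eq slab_def)
  qed
  have "AE x in lborel. x \<notin> W" using AE by eventually_elim (use hW in force)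
  then have "W \<in> null_sets lborel"
    using \<open>open W\<close> by (subst AE_iff_null_sets) auto
  then have "negligible W" by (simp add: negligible_iff_null_sets null_sets_completionI)
  moreover have "W \<noteq> {}"
  proof -
    let ?n = "real CARD('n)"
    have n: "?n > 0" by simp
    \<comment> \<open>The point over \<open>y\<close> with normal coordinate \<open>1/2\<close>, halfway up the prism.\<close>
    define x where "x = y + (\<chi> i. (sqrt ?n / 2 - 1) / ?n)"
    have ysum: "(\<Sum>j\<in>UNIV. y $ j) = 1" using y by (simp add: simplex_pos_def)
    have sum: "(\<Sum>j\<in>UNIV. x $ j) = sqrt ?n / 2"
      by (simp add: x_def sum.distrib ysum)
    have "proj_hyp x = y"
      unfolding proj_hyp_def sum by (simp add: x_def vec_eq_iff flip: add_divide_distrib diff_divide_distrib)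
    then have "x \<in> W" using r(1) by (simp add: W_def sum)
    then show ?thesis by blast
  qed
  ultimately show False using open_not_negligible[OF \<open>open W\<close>] by blast
qed

lemma vanishing_against_test_funs:
  fixes d :: "real^'n::finite \<Rightarrow> real"
  assumes d: "continuous_on simplex_pos d"
    and int: "\<And>\<phi>. test_fun \<phi> \<Longrightarrow> (LINT \<rho>|vol_euclid. \<phi> \<rho> * d \<rho>) = 0"
    and y: "y \<in> simplex_pos"
  shows "d y = 0"
  using vanishing_against_test_funs_nonpos[OF d int y]
    vanishing_against_test_funs_nonpos[of "\<lambda>x. - d x", OF _ _ y] d int
  by (simp add: continuous_on_minus)

lemma smooth_near_iff: "smooth_near S f \<longleftrightarrow> (\<exists>U. open U \<and> S \<subseteq> U \<and> smooth_on U f)"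
  by (auto simp: smooth_near_def smooth_on_def)

lemma smooth_near_continuous_on: "smooth_near S f \<Longrightarrow> continuous_on S f"
  by (auto simp: smooth_near_iff intro: continuous_on_subset dest: smooth_on_continuous_on)

lemma smooth_on_ediv:
  "open U \<Longrightarrow> (\<And>i. smooth_on U (\<lambda>y. X y $ i)) \<Longrightarrow> smooth_on U (ediv X)"
  unfolding ediv_def by (intro smooth_on_intros)

lemma smooth_on_egrad_inner:
  assumes "open U" "\<And>i. smooth_on U (\<lambda>y. X y $ i)" "smooth_on U f"
  shows "smooth_on U (\<lambda>y. egrad f y \<bullet> X y)"
  unfolding inner_vec_def egrad_def by (simp, intro smooth_on_intros assms)

lemma ediv_scaleR:
  assumes "f differentiable (at x)" "\<And>i. (\<lambda>y. X y $ i) differentiable (at x)"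
  shows "ediv (\<lambda>y. f y *\<^sub>R X y) x = f x * ediv X x + egrad f x \<bullet> X x"
  by (simp add: ediv_def partial_mult[OF assms] sum.distrib sum_distrib_left egrad_def inner_vec_def)

text \<open>The axis directions are not tangent to the hyperplane, so they are replaced by their projections
  \<open>axis i 1 - 1/n\<close>. The error is the derivative of \<open>\<Sum>i. X $ i\<close> in a fixed direction, which vanishes
  because \<open>X\<close> is tangent on a whole neighbourhood.\<close>

lemma integral_ediv_tangent_eq_0:
  fixes X :: "real^'n::finite \<Rightarrow> real^'n"
  assumes U: "open U" "simplex_pos \<subseteq> U" and X: "\<And>i. smooth_on U (\<lambda>y. X y $ i)"
    and tangent: "\<And>y. y \<in> U \<Longrightarrow> (\<Sum>i\<in>UNIV. X y $ i) = 0"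
    and K: "compact K" "K \<subseteq> simplex_pos" and zero: "\<And>y. y \<in> simplex_pos - K \<Longrightarrow> X y = 0"
  shows "integrable vol_euclid (ediv X)" "integral\<^sup>L vol_euclid (ediv X) = 0"
proof -
  let ?v = "\<lambda>i :: 'n. axis i 1 - (\<chi> j. 1 / real CARD('n)) :: real^'n"
  have sum_v: "(\<Sum>j\<in>UNIV. ?v i $ j) = 0" for i
    by (simp add: sum_subtractf axis_def)
  have v: "integrable vol_euclid (\<lambda>y. ?v i \<bullet> egrad (\<lambda>y. X y $ i) y)"
    "(LINT y|vol_euclid. ?v i \<bullet> egrad (\<lambda>y. X y $ i) y) = 0" for i
    using integral_tangential_derivative_eq_0[OF sum_v U X K] zero by simp_all
  have eq: "(\<Sum>i\<in>UNIV. ?v i \<bullet> egrad (\<lambda>y. X y $ i) y) = ediv X y" if "y \<in> simplex_pos" for y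
  proof -
    have y: "y \<in> U" using that U by blast
    have "(\<Sum>i\<in>UNIV. \<Sum>j\<in>UNIV. partial j (\<lambda>y. X y $ i) y) = (\<Sum>j\<in>UNIV. partial j (\<lambda>y. \<Sum>i\<in>UNIV. X y $ i) y)"
      by (subst sum.swap) (auto intro!: sum.cong partial_sum[symmetric] smooth_on_differentiable[OF X U(1) y])
    also have "\<dots> = (\<Sum>j\<in>UNIV. partial j (\<lambda>y. 0) y)"
      by (intro sum.cong refl partial_cong_open[OF U(1) y] tangent)
    finally have "(\<Sum>i\<in>UNIV. \<Sum>j\<in>UNIV. partial j (\<lambda>y. X y $ i) y) = 0" by simp
    moreover have "?v i \<bullet> egrad (\<lambda>y. X y $ i) y
        = partial i (\<lambda>y. X y $ i) y - (\<Sum>j\<in>UNIV. partial j (\<lambda>y. X y $ i) y) / real CARD('n)" for i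
      by (simp add: inner_diff_left inner_axis' egrad_def) (simp add: inner_vec_def sum_divide_distrib)
    ultimately show ?thesis
      by (simp add: sum_subtractf ediv_def flip: sum_divide_distrib)
  qed
  have "integrable vol_euclid (\<lambda>y. \<Sum>i\<in>UNIV. ?v i \<bullet> egrad (\<lambda>y. X y $ i) y)"
    by (intro Bochner_Integration.integrable_sum v)
  then show "integrable vol_euclid (ediv X)"
    by (subst (asm) Bochner_Integration.integrable_cong[OF refl]) (use eq in auto)
  have "(LINT y|vol_euclid. (\<Sum>i\<in>UNIV. ?v i \<bullet> egrad (\<lambda>y. X y $ i) y)) = 0"
    by (subst Bochner_Integration.integral_sum) (simp_all add: v)
  then show "integral\<^sup>L vol_euclid (ediv X) = 0"
    by (subst (asm) Bochner_Integration.integral_cong[OF refl]) (use eq in auto)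
qed

section \<open>The divergence\<close>

context
  fixes E :: "('n::finite \<times> 'n) set" and \<omega> :: "'n \<Rightarrow> 'n \<Rightarrow> real"
  assumes graph: "connected_weighted_graph E \<omega>"
begin

text \<open>The divergence in ambient coordinates with respect to the density \<open>\<Pi>\<^sup>-\<^sup>1\<^sup>/\<^sup>2\<close>. On the simplex it turns
  out to be \<open>divW\<close> for tangent fields.\<close>

definition weighted_div :: "(real^'n \<Rightarrow> real^'n) \<Rightarrow> real^'n \<Rightarrow> real" where
  "weighted_div G \<rho> = Pi_ev E \<omega> \<rho> powr (1/2) * ediv (\<lambda>a. Pi_ev E \<omega> a powr (-1/2) *\<^sub>R G a) \<rho>"

lemma Pi_pos: "\<rho> \<in> pos_orthant \<Longrightarrow> Pi_ev E \<omega> \<rho> > 0"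
  by (rule Pi_ev_eq_det(2)[OF graph])

lemma smooth_on_Pi_powr:
  assumes "open U" "U \<subseteq> pos_orthant"
  shows "smooth_on U (\<lambda>a. Pi_ev E \<omega> a powr s)"
  using assms Pi_pos by (intro smooth_on_powr smooth_on_mono[OF smooth_on_Pi_ev[OF graph]]) auto

text \<open>The Leibniz rule; \<open>\<Pi>\<^sup>1\<^sup>/\<^sup>2 d(\<Pi>\<^sup>-\<^sup>1\<^sup>/\<^sup>2)\<close> is minus one half of the logarithmic derivative of \<open>\<Pi>\<close>.\<close>

lemma weighted_div_eq:
  assumes \<rho>: "\<rho> \<in> pos_orthant" and G: "\<And>i. (\<lambda>a. G a $ i) differentiable (at \<rho>)"
  shows "weighted_div G \<rho> = ediv G \<rho> - 1/2 * (G \<rho> \<bullet> egrad (\<lambda>a. ln (Pi_ev E \<omega> a)) \<rho>)"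
proof -
  have pos: "Pi_ev E \<omega> \<rho> > 0" by (rule Pi_pos[OF \<rho>])
  have dPi: "Pi_ev E \<omega> differentiable (at \<rho>)"
    by (rule smooth_on_differentiable[OF smooth_on_Pi_ev[OF graph] open_pos_orthant \<rho>])
  have dw: "(\<lambda>a. Pi_ev E \<omega> a powr (-1/2)) differentiable (at \<rho>)"
    by (rule smooth_on_differentiable[OF smooth_on_Pi_powr[OF open_pos_orthant order_refl] open_pos_orthant \<rho>])
  have "partial i (\<lambda>a. Pi_ev E \<omega> a powr (-1/2)) \<rho> = (-1/2) * Pi_ev E \<omega> \<rho> powr (-3/2) * partial i (Pi_ev E \<omega>) \<rho>" for i
    by (rule partial_compose[OF dPi]) (use pos in \<open>auto intro!: derivative_eq_intros\<close>)
  moreover have "partial i (\<lambda>a. ln (Pi_ev E \<omega> a)) \<rho> = inverse (Pi_ev E \<omega> \<rho>) * partial i (Pi_ev E \<omega>) \<rho>" for i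
    by (rule partial_compose[OF dPi]) (use pos in \<open>auto intro!: derivative_eq_intros simp: field_simps\<close>)
  moreover have "Pi_ev E \<omega> \<rho> powr (1/2) * Pi_ev E \<omega> \<rho> powr (-3/2) = inverse (Pi_ev E \<omega> \<rho>)"
  proof -
    have "Pi_ev E \<omega> \<rho> powr (1/2) * Pi_ev E \<omega> \<rho> powr (-3/2) = Pi_ev E \<omega> \<rho> powr (1/2 + -3/2)"
      by (simp only: powr_add)
    also have "\<dots> = Pi_ev E \<omega> \<rho> powr (-1)" by simp
    also have "\<dots> = inverse (Pi_ev E \<omega> \<rho>)" using pos by (simp only: powr_minus powr_one)
    finally show ?thesis .
  qed
  ultimately have "Pi_ev E \<omega> \<rho> powr (1/2) * partial i (\<lambda>a. Pi_ev E \<omega> a powr (-1/2)) \<rho> = - (1/2) * partial i (\<lambda>a. ln (Pi_ev E \<omega> a)) \<rho>" for i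
    by (simp add: algebra_simps)
  then have "Pi_ev E \<omega> \<rho> powr (1/2) *\<^sub>R egrad (\<lambda>a. Pi_ev E \<omega> a powr (-1/2)) \<rho> = - (1/2) *\<^sub>R egrad (\<lambda>a. ln (Pi_ev E \<omega> a)) \<rho>"
    by (simp add: egrad_def vec_eq_iff)
  then have "Pi_ev E \<omega> \<rho> powr (1/2) * (egrad (\<lambda>a. Pi_ev E \<omega> a powr (-1/2)) \<rho> \<bullet> G \<rho>) = - (1/2) * (egrad (\<lambda>a. ln (Pi_ev E \<omega> a)) \<rho> \<bullet> G \<rho>)"
    by (metis inner_scaleR_left)
  moreover have "Pi_ev E \<omega> \<rho> powr (1/2) * Pi_ev E \<omega> \<rho> powr (-1/2) = 1"
    using pos by (simp flip: powr_add)
  ultimately show ?thesis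
    unfolding weighted_div_def ediv_scaleR[OF dw G] by (simp add: distrib_left inner_commute)
qed

lemma weighted_div_eq_near:
  assumes G: "\<And>i. smooth_near simplex_pos (\<lambda>\<rho>. G \<rho> $ i)" and \<rho>: "\<rho> \<in> simplex_pos"
  shows "weighted_div G \<rho> = ediv G \<rho> - 1/2 * (G \<rho> \<bullet> egrad (\<lambda>a. ln (Pi_ev E \<omega> a)) \<rho>)"
proof -
  have "\<rho> \<in> pos_orthant" using \<rho> simplex_subset_orthant by blast
  moreover have "(\<lambda>a. G a $ i) differentiable (at \<rho>)" for i
    using G[of i] \<rho> unfolding smooth_near_iff by (metis smooth_on_differentiable subsetD)
  ultimately show ?thesis by (rule weighted_div_eq)
qed

lemma smooth_on_weighted_div:
  assumes U: "open U" "U \<subseteq> pos_orthant" and G: "\<And>i. smooth_on U (\<lambda>a. G a $ i)"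
  shows "smooth_on U (weighted_div G)"
  unfolding weighted_div_def
  by (intro smooth_on_mult smooth_on_ediv smooth_on_Pi_powr U) (simp, intro smooth_on_mult smooth_on_Pi_powr U G)

lemma integral_volW:
  assumes f: "continuous_on simplex_pos f"
  shows "integral\<^sup>L (volW E \<omega>) f = (LINT \<rho>|vol_euclid. Pi_ev E \<omega> \<rho> powr (-1/2) * f \<rho>)"
proof -
  have "continuous_on simplex_pos (\<lambda>\<rho>. Pi_ev E \<omega> \<rho> powr (-1/2))"
    using smooth_on_continuous_on[OF smooth_on_Pi_powr[OF open_pos_orthant order_refl]] simplex_subset_orthant
    by (rule continuous_on_subset)
  then show ?thesis unfolding volW_def
    by (subst integral_density) (auto intro!: continuous_on_imp_measurable_vol f)
qed

lemma smooth_tangent_neighbourhood: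
  assumes G: "\<And>i. smooth_near simplex_pos (\<lambda>\<rho>. G \<rho> $ i)"
  obtains U where "open U" "simplex_pos \<subseteq> U" "U \<subseteq> pos_orthant" "\<And>i. smooth_on U (\<lambda>a. G a $ i)"
    "tangent_near_simplex G \<Longrightarrow> \<forall>x\<in>U. (\<Sum>i\<in>UNIV. G x $ i) = 0"
proof -
  obtain U where U: "\<And>i. open (U i)" "\<And>i. simplex_pos \<subseteq> U i" "\<And>i. smooth_on (U i) (\<lambda>a. G a $ i)"
    using G unfolding smooth_near_iff by metis
  obtain T where T: "open T" "simplex_pos \<subseteq> T"
    "tangent_near_simplex G \<Longrightarrow> \<forall>x\<in>T. (\<Sum>i\<in>UNIV. G x $ i) = 0"
    by (metis open_UNIV subset_UNIV tangent_near_simplex_def)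
  show thesis
  proof
    show "open (T \<inter> pos_orthant \<inter> (\<Inter>i. U i))" using T U by (intro open_Int open_INT open_pos_orthant) auto
    show "smooth_on (T \<inter> pos_orthant \<inter> (\<Inter>i. U i)) (\<lambda>a. G a $ i)" for i
      by (rule smooth_on_mono[OF U(3)]) auto
    show "simplex_pos \<subseteq> T \<inter> pos_orthant \<inter> (\<Inter>i. U i)"
      using T(2) U(2) simplex_subset_orthant by blast
  qed (use T(3) in auto)
qed

text \<open>With \<open>Y = w G\<close>, the field \<open>\<phi> Y\<close> is tangent with compact support on the simplex, so its divergence
  \<open>\<phi> \<nabla> \<bullet> Y + w d\<phi> \<bullet> G\<close> has integral zero; because the metric cancels, the second summand is, as an integrand for the Euclidean
  volume, the one on the right-hand side of the integration by parts formula.\<close>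

lemma is_divW_weighted_div:
  assumes G: "\<And>i. smooth_near simplex_pos (\<lambda>\<rho>. G \<rho> $ i)" and tan: "tangent_near_simplex G"
  shows "is_divW E \<omega> G (weighted_div G)"
proof -
  obtain U where U: "open U" "simplex_pos \<subseteq> U" "U \<subseteq> pos_orthant" and GU: "\<And>i. smooth_on U (\<lambda>a. G a $ i)"
    and tanU: "\<forall>x\<in>U. (\<Sum>i\<in>UNIV. G x $ i) = 0"
    using smooth_tangent_neighbourhood[OF G] tan by metis
  have smooth: "smooth_on U (weighted_div G)" by (rule smooth_on_weighted_div[OF U(1,3) GU])
  show ?thesis unfolding is_divW_def
  proof (intro conjI allI impI)
    show "smooth_fun_on simplex_pos (weighted_div G)"
      using smooth U unfolding smooth_fun_on_def smooth_near_iff by blast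
    fix \<phi> :: "real^'n \<Rightarrow> real" assume \<phi>: "test_fun \<phi>"
    then obtain V K where V: "open V" "simplex_pos \<subseteq> V" "smooth_on V \<phi>"
      and K: "compact K" "K \<subseteq> simplex_pos" "\<And>\<rho>. \<rho> \<in> simplex_pos - K \<Longrightarrow> \<phi> \<rho> = 0"
      unfolding test_fun_def smooth_near_iff by blast
    define W where "W = U \<inter> V"
    have W: "open W" "simplex_pos \<subseteq> W" "W \<subseteq> pos_orthant" using U V by (auto simp: W_def)
    have GW: "smooth_on W (\<lambda>a. G a $ i)" for i by (rule smooth_on_mono[OF GU]) (auto simp: W_def)
    have \<phi>W: "smooth_on W \<phi>" by (rule smooth_on_mono[OF V(3)]) (auto simp: W_def)
    let ?w = "\<lambda>a. Pi_ev E \<omega> a powr (-1/2)"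
    let ?Y = "\<lambda>a. ?w a *\<^sub>R G a"
    let ?X = "\<lambda>a. \<phi> a *\<^sub>R ?Y a"
    have wW: "smooth_on W ?w" by (rule smooth_on_Pi_powr[OF W(1,3)])
    have YW: "smooth_on W (\<lambda>a. ?Y a $ i)" for i
      unfolding vector_scaleR_component real_scaleR_def by (intro smooth_on_mult W(1) wW GW)
    have XW: "smooth_on W (\<lambda>a. ?X a $ i)" for i
      unfolding vector_scaleR_component real_scaleR_def by (intro smooth_on_mult W(1) wW GW \<phi>W)
    have cont: "continuous_on simplex_pos f" if "smooth_on W f" for f
      by (rule continuous_on_subset[OF smooth_on_continuous_on[OF that] W(2)])
    have "(\<Sum>i\<in>UNIV. ?X y $ i) = 0" if "y \<in> W" for y
      using tanU that by (simp add: W_def flip: sum_distrib_left)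
    then have X: "integrable vol_euclid (ediv ?X)" "integral\<^sup>L vol_euclid (ediv ?X) = 0"
      using integral_ediv_tangent_eq_0[OF W(1,2) XW _ K(1,2)] K(3) by simp_all
    have pY: "integrable vol_euclid (\<lambda>\<rho>. \<phi> \<rho> * ediv ?Y \<rho>)"
    proof (rule integrable_vol_euclid[OF cont K(1,2)])
      show "smooth_on W (\<lambda>\<rho>. \<phi> \<rho> * ediv ?Y \<rho>)"
        by (intro smooth_on_mult W(1) \<phi>W smooth_on_ediv YW)
    qed (simp add: K(3))
    have "(LINT \<rho>|volW E \<omega>. \<phi> \<rho> * weighted_div G \<rho>) = (LINT \<rho>|vol_euclid. ?w \<rho> * (\<phi> \<rho> * weighted_div G \<rho>))"
      by (intro integral_volW cont smooth_on_mult W(1) \<phi>W smooth_on_mono[OF smooth]) (auto simp: W_def)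
    also have "\<dots> = (LINT \<rho>|vol_euclid. \<phi> \<rho> * ediv ?Y \<rho>)"
    proof (rule Bochner_Integration.integral_cong[OF refl])
      fix \<rho> :: "real^'n" assume "\<rho> \<in> space vol_euclid"
      then have "Pi_ev E \<omega> \<rho> > 0" using simplex_subset_orthant by (intro Pi_pos) auto
      then have "?w \<rho> * Pi_ev E \<omega> \<rho> powr (1/2) = 1" by (simp flip: powr_add)
      then show "?w \<rho> * (\<phi> \<rho> * weighted_div G \<rho>) = \<phi> \<rho> * ediv ?Y \<rho>"
        unfolding weighted_div_def by (metis (no_types, lifting) mult.assoc mult.commute mult.left_neutral)
    qed
    also have "\<dots> = - (LINT \<rho>|vol_euclid. ediv ?X \<rho> - \<phi> \<rho> * ediv ?Y \<rho>)"
      using X pY by simp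
    also have "(LINT \<rho>|vol_euclid. ediv ?X \<rho> - \<phi> \<rho> * ediv ?Y \<rho>) = (LINT \<rho>|vol_euclid. ?w \<rho> * (egrad \<phi> \<rho> \<bullet> G \<rho>))"
    proof (rule Bochner_Integration.integral_cong[OF refl])
      fix \<rho> :: "real^'n" assume "\<rho> \<in> space vol_euclid"
      then have \<rho>: "\<rho> \<in> W" using W by auto
      show "ediv ?X \<rho> - \<phi> \<rho> * ediv ?Y \<rho> = ?w \<rho> * (egrad \<phi> \<rho> \<bullet> G \<rho>)"
        by (subst ediv_scaleR[OF smooth_on_differentiable[OF \<phi>W W(1) \<rho>] smooth_on_differentiable[OF YW W(1) \<rho>]]) simp
    qed
    also have "\<dots> = (LINT \<rho>|volW E \<omega>. egrad \<phi> \<rho> \<bullet> G \<rho>)"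
      by (intro integral_volW[symmetric] cont smooth_on_egrad_inner W(1) GW \<phi>W)
    also have "\<dots> = (LINT \<rho>|volW E \<omega>. gW E \<omega> \<rho> (gradW E \<omega> \<phi> \<rho>) (G \<rho>))"
    proof (rule Bochner_Integration.integral_cong[OF refl])
      fix \<rho> assume "\<rho> \<in> space (volW E \<omega>)"
      then have "\<rho> \<in> simplex_pos" by (simp add: volW_def)
      then show "egrad \<phi> \<rho> \<bullet> G \<rho> = gW E \<omega> \<rho> (gradW E \<omega> \<phi> \<rho>) (G \<rho>)"
        using gW_gradW[OF graph] simplex_subset_orthant tanU U by (metis subsetD)
    qed
    finally show "(LINT \<rho>|volW E \<omega>. \<phi> \<rho> * weighted_div G \<rho>)
        = - (LINT \<rho>|volW E \<omega>. gW E \<omega> \<rho> (gradW E \<omega> \<phi> \<rho>) (G \<rho>))" .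
  qed
qed

text \<open>The difference, multiplied by the density of the volume, is continuous and orthogonal to all test
  functions with respect to the Euclidean volume.\<close>

lemma is_divW_unique:
  assumes D1: "is_divW E \<omega> G D1" and D2: "is_divW E \<omega> G D2" and \<rho>: "\<rho> \<in> simplex_pos"
  shows "D1 \<rho> = D2 \<rho>"
proof -
  let ?w = "\<lambda>a. Pi_ev E \<omega> a powr (-1/2)"
  have cont: "continuous_on simplex_pos D" if "is_divW E \<omega> G D" for D
    using that unfolding is_divW_def smooth_fun_on_def
    by (metis (no_types, lifting) continuous_on_cong smooth_near_continuous_on)
  have cw: "continuous_on simplex_pos ?w"
    using smooth_on_continuous_on[OF smooth_on_Pi_powr[OF open_pos_orthant order_refl]] simplex_subset_orthant
    by (rule continuous_on_subset)
  have "?w \<rho> * (D1 \<rho> - D2 \<rho>) = 0"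
  proof (rule vanishing_against_test_funs[OF _ _ \<rho>])
    show "continuous_on simplex_pos (\<lambda>\<rho>. ?w \<rho> * (D1 \<rho> - D2 \<rho>))"
      by (intro continuous_on_mult continuous_on_diff cw cont[OF D1] cont[OF D2])
    fix \<phi> :: "real^'n \<Rightarrow> real" assume \<phi>: "test_fun \<phi>"
    then obtain K where K: "compact K" "K \<subseteq> simplex_pos" "\<And>\<rho>. \<rho> \<in> simplex_pos - K \<Longrightarrow> \<phi> \<rho> = 0"
      by (auto simp: test_fun_def)
    have c\<phi>: "continuous_on simplex_pos \<phi>" using \<phi> by (simp add: test_fun_def smooth_near_continuous_on)
    have int: "integrable vol_euclid (\<lambda>\<rho>. ?w \<rho> * (\<phi> \<rho> * D \<rho>))" if "is_divW E \<omega> G D" for D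
      by (rule integrable_vol_euclid[OF continuous_on_mult[OF cw continuous_on_mult[OF c\<phi> cont[OF that]]] K(1,2)])
        (simp add: K(3))
    have vol: "(LINT \<rho>|volW E \<omega>. \<phi> \<rho> * D \<rho>) = (LINT \<rho>|vol_euclid. ?w \<rho> * (\<phi> \<rho> * D \<rho>))" if "is_divW E \<omega> G D" for D
      by (intro integral_volW continuous_on_mult c\<phi> cont[OF that])
    have "(LINT \<rho>|vol_euclid. \<phi> \<rho> * (?w \<rho> * (D1 \<rho> - D2 \<rho>)))
        = (LINT \<rho>|vol_euclid. ?w \<rho> * (\<phi> \<rho> * D1 \<rho>) - ?w \<rho> * (\<phi> \<rho> * D2 \<rho>))"
      by (simp add: algebra_simps)
    also have "\<dots> = (LINT \<rho>|volW E \<omega>. \<phi> \<rho> * D1 \<rho>) - (LINT \<rho>|volW E \<omega>. \<phi> \<rho> * D2 \<rho>)"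
      unfolding vol[OF D1] vol[OF D2]
      by (rule Bochner_Integration.integral_diff[OF int[OF D1] int[OF D2]])
    also have "\<dots> = 0" using D1 D2 \<phi> by (simp add: is_divW_def)
    finally show "(LINT \<rho>|vol_euclid. \<phi> \<rho> * (?w \<rho> * (D1 \<rho> - D2 \<rho>))) = 0" .
  qed
  moreover have "Pi_ev E \<omega> \<rho> > 0" using \<rho> simplex_subset_orthant by (intro Pi_pos) auto
  ultimately show ?thesis by simp
qed

lemma smooth_fun_on_cong: "(\<And>x. x \<in> S \<Longrightarrow> f x = g x) \<Longrightarrow> smooth_fun_on S f \<longleftrightarrow> smooth_fun_on S g"
  by (simp add: smooth_fun_on_def)

lemma divW_eq_weighted_div:
  assumes G: "\<And>i. smooth_near simplex_pos (\<lambda>\<rho>. G \<rho> $ i)" and tan: "tangent_near_simplex G"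
  shows "smooth_fun_on simplex_pos (divW E \<omega> G)"
    and "\<And>\<rho>. \<rho> \<in> simplex_pos \<Longrightarrow> divW E \<omega> G \<rho> = weighted_div G \<rho>"
proof -
  note div = is_divW_weighted_div[OF G tan]
  let ?D = "restrict (weighted_div G) simplex_pos"
  have D: "is_divW E \<omega> G ?D"
  proof -
    have "(LINT \<rho>|volW E \<omega>. \<phi> \<rho> * ?D \<rho>) = (LINT \<rho>|volW E \<omega>. \<phi> \<rho> * weighted_div G \<rho>)" for \<phi>
      by (rule Bochner_Integration.integral_cong[OF refl]) (simp add: volW_def)
    then show ?thesis
      using div smooth_fun_on_cong[of simplex_pos ?D "weighted_div G"] by (simp add: is_divW_def)
  qed
  have "divW E \<omega> G = ?D"
    unfolding divW_def
  proof (rule the_equality)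
    fix D' assume D': "D' \<in> extensional simplex_pos \<and> is_divW E \<omega> G D'"
    show "D' = ?D"
      by (rule extensionalityI[of _ simplex_pos]) (use D' is_divW_unique[OF _ D] in auto)
  qed (use D in auto)
  then show "smooth_fun_on simplex_pos (divW E \<omega> G)"
    "\<And>\<rho>. \<rho> \<in> simplex_pos \<Longrightarrow> divW E \<omega> G \<rho> = weighted_div G \<rho>"
    using D by (simp_all add: is_divW_def)
qed

section \<open>The Laplace-Beltrami operator\<close>

lemma smooth_tangent_gradW:
  assumes F: "smooth_near simplex_pos F"
  shows "smooth_near simplex_pos (\<lambda>\<rho>. gradW E \<omega> F \<rho> $ i)" "tangent_near_simplex (gradW E \<omega> F)"
proof -
  obtain U where U: "open U" "simplex_pos \<subseteq> U" "smooth_on U F" using F by (auto simp: smooth_near_iff)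
  have "smooth_on U (\<lambda>\<rho>. gradW E \<omega> F \<rho> $ i)"
    unfolding gradW_def matrix_vector_mult_def egrad_def
    by (simp, intro smooth_on_intros smooth_on_Lap_entry[OF graph] U)
  then show "smooth_near simplex_pos (\<lambda>\<rho>. gradW E \<omega> F \<rho> $ i)" using U by (auto simp: smooth_near_iff)
  show "tangent_near_simplex (gradW E \<omega> F)"
    unfolding tangent_near_simplex_def gradW_def using Lap_mult_sum[OF graph] by (intro exI[of _ UNIV]) auto
qed

text \<open>No first derivatives of \<open>F\<close> remain: differentiating \<open>\<theta>\<close> contributes
  \<open>\<omega> i j / 2 * (\<partial>\<^sub>i F - \<partial>\<^sub>j F)\<close>, which is antisymmetric in \<open>i\<close> and \<open>j\<close> and sums to zero.\<close>

lemma ediv_gradW: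
  assumes U: "open U" "smooth_on U F" and \<rho>: "\<rho> \<in> U"
  shows "ediv (gradW E \<omega> F) \<rho>
    = (\<Sum>i\<in>UNIV. \<Sum>j\<in>UNIV. \<omega> i j * theta \<rho> i j * (partial i (partial i F) \<rho> - partial i (partial j F) \<rho>))"
proof -
  have dF: "partial j F differentiable (at \<rho>)" for j
    by (rule smooth_on_differentiable[OF smooth_on_partial[OF U(2)] U(1) \<rho>])
  have dt: "(\<lambda>a. theta a i j) differentiable (at \<rho>)" for i j
    unfolding theta_def divide_inverse
    by (rule smooth_on_differentiable[OF _ open_UNIV UNIV_I]) (intro smooth_on_intros open_UNIV)
  have pt: "i \<noteq> j \<Longrightarrow> partial i (\<lambda>a. theta a i j) \<rho> = 1/2" for i j :: 'n
  proof -
    assume "i \<noteq> j"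
    have c: "(\<lambda>a::real^'n. a $ k) differentiable (at \<rho>)" for k
      by (rule smooth_on_differentiable[OF smooth_on_coord open_UNIV UNIV_I])
    show ?thesis
      using partial_mult[OF differentiable_const[of "1/2"] differentiable_add[OF c[of i] c[of j]], of i]
        partial_add[OF c[of i] c[of j], of i] \<open>i \<noteq> j\<close>
      by (simp add: theta_def partial_coord)
  qed
  have term_eq: "partial i (\<lambda>a. \<omega> i j * theta a i j * (partial i F a - partial j F a)) \<rho>
      = \<omega> i j * (1/2) * (partial i F \<rho> - partial j F \<rho>)
        + \<omega> i j * theta \<rho> i j * (partial i (partial i F) \<rho> - partial i (partial j F) \<rho>)" for i j
  \<comment> \<open>For \<open>i = j\<close> the derivative of \<open>\<theta>\<close> is \<open>1\<close> instead of \<open>1/2\<close>, but its coefficient is zero.\<close>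
  proof (cases "i = j")
    case False
    have sub: "partial i (\<lambda>a. partial i F a - partial j F a) \<rho> = partial i (partial i F) \<rho> - partial i (partial j F) \<rho>"
      using partial_eq_derivative[OF has_derivative_diff[OF dF[THEN has_derivative_egrad] dF[THEN has_derivative_egrad]], of i i j]
      by (simp add: inner_axis' egrad_def)
    have "partial i (\<lambda>a. \<omega> i j * theta a i j) \<rho> = \<omega> i j * (1/2)"
      using partial_mult[OF differentiable_const[of "\<omega> i j"] dt[of i j], of i] pt[OF False] by simp
    then show ?thesis
      using partial_mult[of "\<lambda>a. \<omega> i j * theta a i j" \<rho> "\<lambda>a. partial i F a - partial j F a" i] sub
      by (simp add: dF dt)
  qed simp
  have "ediv (gradW E \<omega> F) \<rho>
      = (\<Sum>i\<in>UNIV. \<Sum>j\<in>UNIV. partial i (\<lambda>a. \<omega> i j * theta a i j * (partial i F a - partial j F a)) \<rho>)"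
    unfolding ediv_def gradW_def Lap_mult[OF graph] egrad_def vec_lambda_beta
    by (intro sum.cong refl partial_sum) (simp add: dF dt)
  also have "\<dots> = (\<Sum>i\<in>UNIV. \<Sum>j\<in>UNIV. \<omega> i j * (1/2) * (partial i F \<rho> - partial j F \<rho>))
      + (\<Sum>i\<in>UNIV. \<Sum>j\<in>UNIV. \<omega> i j * theta \<rho> i j * (partial i (partial i F) \<rho> - partial i (partial j F) \<rho>))"
    unfolding term_eq by (simp only: sum.distrib)
  also have "(\<Sum>i\<in>UNIV. \<Sum>j\<in>UNIV. \<omega> i j * (1/2) * (partial i F \<rho> - partial j F \<rho>)) = 0" (is "?S = 0")
  proof -
    have "?S = - ?S"
      unfolding sum_negf[symmetric]
      by (subst sum.swap, intro sum.cong refl, subst weight_commute[OF graph]) (simp add: algebra_simps)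
    then show ?thesis by simp
  qed
  finally show ?thesis by simp
qed

end

text \<open>The summand must vanish on the diagonal since a loop lies in the orientation and in its converse,
  and would be counted twice on the right.\<close>

lemma sum_orientation:
  fixes f :: "'n::finite \<Rightarrow> 'n \<Rightarrow> real"
  assumes Eo: "orientation_of E Eo" and outside: "\<And>i j. (i, j) \<notin> E \<Longrightarrow> f i j = 0"
    and diag: "\<And>i. f i i = 0"
  shows "(\<Sum>i\<in>UNIV. \<Sum>j\<in>UNIV. f i j) = (\<Sum>(i, j)\<in>Eo. f i j + f j i)"
proof -
  let ?f = "\<lambda>(i, j). f i j"
  have "(\<Sum>i\<in>UNIV. \<Sum>j\<in>UNIV. f i j) = sum ?f UNIV"
    by (simp add: sum.cartesian_product)
  also have "\<dots> = sum ?f (Eo \<union> Eo\<inverse>)"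
    using Eo outside by (intro sum.mono_neutral_right) (auto simp: orientation_of_def)
  also have "\<dots> = sum ?f (Eo \<union> Eo\<inverse>) + sum ?f (Eo \<inter> Eo\<inverse>)"
    using Eo diag by (subst sum.neutral[of "Eo \<inter> Eo\<inverse>"]) (auto simp: orientation_of_def antisym_def)
  also have "\<dots> = sum ?f Eo + sum ?f (Eo\<inverse>)"
    by (rule sum.union_inter) simp_all
  also have "sum ?f (Eo\<inverse>) = (\<Sum>(i, j)\<in>Eo. f j i)"
    by (rule sum.reindex_bij_witness[of _ prod.swap prod.swap]) auto
  finally show ?thesis by (simp add: sum.distrib case_prod_unfold)
qed

theorem proposition8:
  fixes E Eo :: "('n::finite \<times> 'n) set" and \<omega> :: "'n \<Rightarrow> 'n \<Rightarrow> real"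
  assumes "connected_weighted_graph E \<omega>"
    and "orientation_of E Eo"
  shows
    "(\<forall>G :: real^'n \<Rightarrow> real^'n. (\<forall>i. smooth_near simplex_pos (\<lambda>\<rho>. G \<rho> $ i)) \<longrightarrow>
        (tangent_near_simplex G \<longrightarrow>
          smooth_fun_on simplex_pos (divW E \<omega> G) \<and>
          (\<forall>\<rho>\<in>simplex_pos.
            divW E \<omega> G \<rho> =
              Pi_ev E \<omega> \<rho> powr (1/2) * ediv (\<lambda>a. Pi_ev E \<omega> a powr (-1/2) *\<^sub>R G a) \<rho>)) \<and>
        (\<forall>\<rho>\<in>simplex_pos.
          Pi_ev E \<omega> \<rho> powr (1/2) * ediv (\<lambda>a. Pi_ev E \<omega> a powr (-1/2) *\<^sub>R G a) \<rho> =
            ediv G \<rho> - 1/2 * (G \<rho> \<bullet> egrad (\<lambda>a. ln (Pi_ev E \<omega> a)) \<rho>)))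
     \<and>
     (\<forall>F :: real^'n \<Rightarrow> real. smooth_near simplex_pos F \<longrightarrow>
        smooth_fun_on simplex_pos (LaplaceW E \<omega> F) \<and>
        (\<forall>\<rho>\<in>simplex_pos.
          LaplaceW E \<omega> F \<rho> =
            Pi_ev E \<omega> \<rho> powr (1/2) *
              ediv (\<lambda>a. Pi_ev E \<omega> a powr (-1/2) *\<^sub>R (Lap E \<omega> a *v egrad F a)) \<rho> \<and>
          LaplaceW E \<omega> F \<rho> =
            trace (Lap E \<omega> \<rho> ** ehess F \<rho>) -
              1/2 * (egrad F \<rho> \<bullet> (Lap E \<omega> \<rho> *v egrad (\<lambda>a. ln (Pi_ev E \<omega> a)) \<rho>)) \<and>
          LaplaceW E \<omega> F \<rho> =
            (\<Sum>(i, j)\<in>Eo. \<omega> i j * theta \<rho> i j *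
              (partial i (partial i F) \<rho> - 2 * partial i (partial j F) \<rho> + partial j (partial j F) \<rho>)) -
            1/2 * (\<Sum>(i, j)\<in>Eo. ngrad \<omega> i j (egrad (\<lambda>a. ln (Pi_ev E \<omega> a)) \<rho>) *
              ngrad \<omega> i j (egrad F \<rho>) * theta \<rho> i j)))"
proof (intro conjI allI impI ballI)
  note graph = assms(1) and Eo = assms(2)
  fix G :: "real^'n \<Rightarrow> real^'n"
  assume G: "\<forall>i. smooth_near simplex_pos (\<lambda>\<rho>. G \<rho> $ i)"
  note G' = G[rule_format]
  show "smooth_fun_on simplex_pos (divW E \<omega> G)" if "tangent_near_simplex G"
    by (rule divW_eq_weighted_div(1)[OF graph G' that])
  fix \<rho> :: "real^'n" assume \<rho>: "\<rho> \<in> simplex_pos"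
  show "divW E \<omega> G \<rho> = Pi_ev E \<omega> \<rho> powr (1/2) * ediv (\<lambda>a. Pi_ev E \<omega> a powr (-1/2) *\<^sub>R G a) \<rho>"
    if "tangent_near_simplex G"
    unfolding weighted_div_def[OF graph, symmetric] by (rule divW_eq_weighted_div(2)[OF graph G' that \<rho>])
  show "Pi_ev E \<omega> \<rho> powr (1/2) * ediv (\<lambda>a. Pi_ev E \<omega> a powr (-1/2) *\<^sub>R G a) \<rho> =
            ediv G \<rho> - 1/2 * (G \<rho> \<bullet> egrad (\<lambda>a. ln (Pi_ev E \<omega> a)) \<rho>)"
    unfolding weighted_div_def[OF graph, symmetric]
    by (rule weighted_div_eq_near[OF graph G' \<rho>])
next
  note graph = assms(1) and Eo = assms(2)
  fix F :: "real^'n \<Rightarrow> real" assume F: "smooth_near simplex_pos F"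
  note G = smooth_tangent_gradW[OF graph F]
  note div = divW_eq_weighted_div[OF graph G, folded LaplaceW_def]
  show "smooth_fun_on simplex_pos (LaplaceW E \<omega> F)" by (rule div(1))
  fix \<rho> :: "real^'n" assume \<rho>: "\<rho> \<in> simplex_pos"
  show "LaplaceW E \<omega> F \<rho> = Pi_ev E \<omega> \<rho> powr (1/2) *
              ediv (\<lambda>a. Pi_ev E \<omega> a powr (-1/2) *\<^sub>R (Lap E \<omega> a *v egrad F a)) \<rho>"
    using div(2)[OF \<rho>] by (simp add: weighted_div_def[OF graph] gradW_def)
  let ?e = "egrad (\<lambda>a. ln (Pi_ev E \<omega> a)) \<rho>"
  obtain U where U: "open U" "simplex_pos \<subseteq> U" "smooth_on U F" using F by (auto simp: smooth_near_iff)
  have \<rho>U: "\<rho> \<in> U" using \<rho> U(2) by blast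
  have L: "LaplaceW E \<omega> F \<rho> = (\<Sum>i\<in>UNIV. \<Sum>j\<in>UNIV. \<omega> i j * theta \<rho> i j * (partial i (partial i F) \<rho> - partial i (partial j F) \<rho>))
      - 1/2 * (egrad F \<rho> \<bullet> (Lap E \<omega> \<rho> *v ?e))"
  proof -
    have "LaplaceW E \<omega> F \<rho> = ediv (gradW E \<omega> F) \<rho> - 1/2 * (gradW E \<omega> F \<rho> \<bullet> ?e)"
      using div(2)[OF \<rho>] weighted_div_eq_near[OF graph G(1) \<rho>] by simp
    moreover have "gradW E \<omega> F \<rho> \<bullet> ?e = egrad F \<rho> \<bullet> (Lap E \<omega> \<rho> *v ?e)"
      using dot_lmul_matrix[of "egrad F \<rho>" "Lap E \<omega> \<rho>" ?e] Lap_symmetric[OF graph, of \<rho>]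
      by (simp add: gradW_def flip: transpose_matrix_vector)
    ultimately show ?thesis by (simp add: ediv_gradW[OF graph U(1,3) \<rho>U])
  qed
  have "trace (Lap E \<omega> \<rho> ** ehess F \<rho>) = (\<Sum>i\<in>UNIV. (Lap E \<omega> \<rho> *v (\<chi> j. partial i (partial j F) \<rho>)) $ i)"
    by (simp add: trace_def matrix_matrix_mult_def matrix_vector_mult_def ehess_def
        partial_commute[OF U(1,3) \<rho>U])
  then have tr: "trace (Lap E \<omega> \<rho> ** ehess F \<rho>) = (\<Sum>i\<in>UNIV. \<Sum>j\<in>UNIV. \<omega> i j * theta \<rho> i j * (partial i (partial i F) \<rho> - partial i (partial j F) \<rho>))"
    by (simp add: Lap_mult[OF graph])
  show "LaplaceW E \<omega> F \<rho> = trace (Lap E \<omega> \<rho> ** ehess F \<rho>) - 1/2 * (egrad F \<rho> \<bullet> (Lap E \<omega> \<rho> *v ?e))"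
    unfolding tr by (rule L)
  have orient: "(\<Sum>i\<in>UNIV. \<Sum>j\<in>UNIV. \<omega> i j * theta \<rho> i j * (partial i (partial i F) \<rho> - partial i (partial j F) \<rho>))
      = (\<Sum>(i, j)\<in>Eo. \<omega> i j * theta \<rho> i j *
              (partial i (partial i F) \<rho> - 2 * partial i (partial j F) \<rho> + partial j (partial j F) \<rho>))"
  proof (subst sum_orientation[OF Eo], goal_cases)
    case 3
    have "\<omega> i j * theta \<rho> i j * (partial i (partial i F) \<rho> - partial i (partial j F) \<rho>)
        + \<omega> j i * theta \<rho> j i * (partial j (partial j F) \<rho> - partial j (partial i F) \<rho>)
        = \<omega> i j * theta \<rho> i j *
              (partial i (partial i F) \<rho> - 2 * partial i (partial j F) \<rho> + partial j (partial j F) \<rho>)" for i j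
      unfolding weight_commute[OF graph, of j i] theta_commute[of \<rho> j i] partial_commute[OF U(1,3) \<rho>U, of j i]
      by (simp add: algebra_simps)
    then show ?case by simp
  qed (simp_all add: weight_outside[OF graph])
  have grad: "egrad F \<rho> \<bullet> (Lap E \<omega> \<rho> *v ?e)
      = (\<Sum>(i, j)\<in>Eo. ngrad \<omega> i j ?e * ngrad \<omega> i j (egrad F \<rho>) * theta \<rho> i j)"
  proof -
    have "egrad F \<rho> \<bullet> (Lap E \<omega> \<rho> *v ?e)
        = (\<Sum>i\<in>UNIV. \<Sum>j\<in>UNIV. \<omega> i j * theta \<rho> i j * (egrad F \<rho> $ i * (?e $ i - ?e $ j)))"
      by (simp add: inner_vec_def Lap_mult[OF graph] sum_distrib_left ac_simps)
    also have "\<dots> = (\<Sum>(i, j)\<in>Eo. ngrad \<omega> i j ?e * ngrad \<omega> i j (egrad F \<rho>) * theta \<rho> i j)"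
    proof (subst sum_orientation[OF Eo], goal_cases)
      case 3
      have "\<omega> i j * theta \<rho> i j * (egrad F \<rho> $ i * (?e $ i - ?e $ j))
          + \<omega> j i * theta \<rho> j i * (egrad F \<rho> $ j * (?e $ j - ?e $ i))
          = ngrad \<omega> i j ?e * ngrad \<omega> i j (egrad F \<rho>) * theta \<rho> i j" for i j
      proof -
        have "ngrad \<omega> i j ?e * ngrad \<omega> i j (egrad F \<rho>) * theta \<rho> i j
            = (sqrt (\<omega> i j) * sqrt (\<omega> i j)) * theta \<rho> i j * ((?e $ i - ?e $ j) * (egrad F \<rho> $ i - egrad F \<rho> $ j))"
          by (simp only: ngrad_def mult_ac)
        also have "sqrt (\<omega> i j) * sqrt (\<omega> i j) = \<omega> i j" using weight_nonneg[OF graph] by simp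
        finally show ?thesis
          unfolding weight_commute[OF graph, of j i] theta_commute[of \<rho> j i]
          by (simp add: algebra_simps)
      qed
      then show ?case by simp
    qed (simp_all add: weight_outside[OF graph])
    finally show ?thesis .
  qed
  show "LaplaceW E \<omega> F \<rho> =
            (\<Sum>(i, j)\<in>Eo. \<omega> i j * theta \<rho> i j *
              (partial i (partial i F) \<rho> - 2 * partial i (partial j F) \<rho> + partial j (partial j F) \<rho>)) -
            1/2 * (\<Sum>(i, j)\<in>Eo. ngrad \<omega> i j ?e * ngrad \<omega> i j (egrad F \<rho>) * theta \<rho> i j)"
    unfolding L orient grad ..
qed

end
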